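(* For all $w\in S_n$, $$\mathrm{MC}(X(w)^\circ)=\widetilde{Z}^\square_{1_W,w_0w}(\boldsymbol{x};\boldsymbol{y}_{w_0})\qquad\text{and}\qquad \mathrm{MC}(Y(w)^\circ)=\widetilde{Z}^\square_{1_W,w}(\boldsymbol{x};\boldsymbol{y}).$$
   Context: $W=S_n$, $1_W$ the identity, $s_i=(i,i+1)$, $w_0(i)=n+1-i$, $<$ the Bruhat order, products are compositions; $\boldsymbol{y}_{w_0}=(y_n,\dots,y_1)$; $\boldsymbol{x}^{\alpha_i}=x_i/x_{i+1}$; $s_i$ acts on functions of $(\boldsymbol{x};\boldsymbol{y})$ by exchanging $x_i,x_{i+1}$ (fixing $\boldsymbol{y}$); $t$ is an indeterminate. Lifted double motivic Chern classes: with $$T_i=\frac{-1+t}{1-\boldsymbol{x}^{-\alpha_i}}+\frac{1-t\boldsymbol{x}^{\alpha_i}}{1-\boldsymbol{x}^{-\alpha_i}}s_i$$ they are determined by $\mathrm{MC}(X(1_W)^\circ)=\prod_{i<j}(1-x_i/y_j)$ and $\mathrm{MC}(X(ws_i)^\circ)=T_i\mathrm{MC}(X(w)^\circ)$ if $ws_i>w$; and $\mathrm{MC}(Y(w_0)^\circ)=\prod_{i+j\le n}(1-x_i/y_j)$ and $\mathrm{MC}(Y(ws_i)^\circ)=T_i\mathrm{MC}(Y(w)^\circ)$ if $ws_i<w$. Lattice model for $\widetilde Z^\square$ ($\square=(n,n-1,\dots,1)$): an $n\times n$ square grid with rows numbered $1,\dots,n$ from top to bottom and columns numbered $1,\dots,n$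 from right to left; the vertex in row $i$, column $j$ has parameters $x=x_i$, $y=y_j$. Horizontal edges carry a spin in $\{+,1,\dots,n\}$ ($+$ = uncolored), vertical edges carry a subset of the color set $\{1<\dots<n\}$. The weight of a vertex with left spin $L$, top spin $\Sigma$, right spin $L'$, bottom spin $\Sigma'$, written $(L,\Sigma;L',\Sigma')$, is zero unless listed ($\Sigma_{>c},\Sigma_{<c},\Sigma_{(c,d)}$ denote the sets of elements of $\Sigma$ that are $>c$, $<c$, strictly between $c$ and $d$): (1) $(+,\Sigma;+,\Sigma)$: $(-tx)^{|\Sigma|}$. (2) $(c,\Sigma;c,\Sigma)$: $t^{|\Sigma_{>c}|}x^{|\Sigma|}(-x^{-1}+t^{\delta}y^{-1})$ with $\delta=1$ if $c\in\Sigma$, else $0$. (3) $(+,\Sigma;c,\Sigma\setminus\{c\})$, $c\in\Sigma$: $(-t)^{|\Sigma_{<c}|}t^{|\Sigma_{>c}|}x^{|\Sigma|-1}$. (4) $(c,\Sigma;+,\Sigma\cup\{c\})$, $c\notin\Sigma$: $(t-1)x^{-1}(-t)^{|\Sigma_{>c}|}x^{|\Sigma|+1}$. (5) $(c,\Sigma;d,(\Sigma\cup\{c\})\setminus\{d\})$, $c<d$, $d\in\Sigma$, $c\notin\Sigma$: $(t-1)x^{-1}(-t)^{|\Sigma_{(c,d)}|}t^{|\Sigma_{>d}|}x^{|\Sigma|}$. (6) $(d,\Sigma;c,(\Sigma\cup\{d\})\setminus\{c\})$, $c<d$, $c\in\Sigma$, $d\notin\Sigma$: $(t-1)y^{-1}(-1)^{|\Sigma_{(c,d)}|}t^{|\Sigma_{>d}|}x^{|\Sigma|}$.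 $\widetilde Z^\square_{\sigma,w}(\boldsymbol{x};\boldsymbol{y})$ is the partition function, i.e. the sum over all assignments of spins to interior edges of the product of the vertex weights, with boundary conditions: the top boundary edge in column $j$ carries the single color $\sigma(j)$; the right boundary edge in row $i$ has color $w(i)$; left and bottom boundary edges are uncolored.
   Formalization: Both equalities are proved with an extra global sign (-1)^{n(n-1)/2} before the partition function; with the weights as listed the sign-free claim fails, e.g. n=2, w=1_W: MC = 1-x_1/y_2 but Z = -(1-x_1/y_2). *)

theory Defs
  imports
    "HOL-Library.Poly_Mapping"
    "HOL-Library.FuncSet"
    "HOL-Combinatorics.Permutations"
    "HOL-Computational_Algebra.Fraction_Field"
begin

section \<open>The field of rational functions in the x, the y and t\<close>

datatype indet = Xv nat | Yv nat | Tv

text \<open>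
  The linear order on the indeterminates is only needed to make the polynomial ring an
  instance of \<^class>\<open>idom\<close>; it plays no other role.
\<close>

fun indet_rank :: "indet \<Rightarrow> nat" where
  "indet_rank (Xv i) = 3 * i"
| "indet_rank (Yv i) = 3 * i + 1"
| "indet_rank Tv = 2"

lemma indet_rank_inject: "indet_rank u = indet_rank v \<Longrightarrow> u = v"
  by (cases u; cases v; simp; presburger)

instantiation indet :: linorder
begin

definition less_eq_indet :: "indet \<Rightarrow> indet \<Rightarrow> bool" where
  "less_eq_indet u v \<longleftrightarrow> indet_rank u \<le> indet_rank v"

definition less_indet :: "indet \<Rightarrow> indet \<Rightarrow> bool" where
  "less_indet u v \<longleftrightarrow> indet_rank u < indet_rank v"

instance
  by standard (auto simp: less_eq_indet_def less_indet_def intro: indet_rank_inject)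

end

type_synonym polyring = "(indet \<Rightarrow>\<^sub>0 nat) \<Rightarrow>\<^sub>0 int"
type_synonym ratfun = "polyring fract"

definition indet_poly :: "indet \<Rightarrow> polyring" where
  "indet_poly v = Poly_Mapping.single (Poly_Mapping.single v 1) 1"

definition xvar :: "nat \<Rightarrow> ratfun" where "xvar i = Fract (indet_poly (Xv i)) 1"
definition yvar :: "nat \<Rightarrow> ratfun" where "yvar j = Fract (indet_poly (Yv j)) 1"
definition tvar :: ratfun where "tvar = Fract (indet_poly Tv) 1"

section \<open>The action exchanging two consecutive x-variables\<close>

definition swap_indet :: "nat \<Rightarrow> indet \<Rightarrow> indet" where
  "swap_indet i v = (case v of Xv k \<Rightarrow> Xv (transpose i (i + 1) k) | _ \<Rightarrow> v)"

text \<open>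
  \<^const>\<open>Poly_Mapping.map_key\<close> precomposes with its argument (pullback of exponents and of
  coefficients). As the exchange of two variables is an involution, pullback and
  substitution coincide.
\<close>

definition swap_mono :: "nat \<Rightarrow> (indet \<Rightarrow>\<^sub>0 nat) \<Rightarrow> (indet \<Rightarrow>\<^sub>0 nat)" where
  "swap_mono i = Poly_Mapping.map_key (swap_indet i)"

definition swap_poly :: "nat \<Rightarrow> polyring \<Rightarrow> polyring" where
  "swap_poly i = Poly_Mapping.map_key (swap_mono i)"

lemma swap_indet_invol [simp]: "swap_indet i (swap_indet i v) = v"
  by (cases v) (simp_all add: swap_indet_def)

lemma inj_swap_indet [simp]: "inj (swap_indet i)"
  by (metis injI swap_indet_invol)

lemma swap_mono_invol [simp]: "swap_mono i (swap_mono i m) = m"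
proof -
  have "swap_indet i \<circ> swap_indet i = (\<lambda>x. x)" by auto
  then show ?thesis
    unfolding swap_mono_def by (simp add: map_key_compose map_key_id)
qed

lemma inj_swap_mono [simp]: "inj (swap_mono i)"
  by (metis injI swap_mono_invol)

lemma swap_poly_invol [simp]: "swap_poly i (swap_poly i p) = p"
proof -
  have "swap_mono i \<circ> swap_mono i = (\<lambda>x. x)" by auto
  then show ?thesis
    unfolding swap_poly_def by (simp add: map_key_compose map_key_id)
qed

lemma swap_mono_add: "swap_mono i (m + m') = swap_mono i m + swap_mono i m'"
  by (simp add: swap_mono_def map_key_plus)

lemma swap_poly_zero [simp]: "swap_poly i 0 = 0"
  by (simp add: swap_poly_def)

lemma swap_poly_add: "swap_poly i (p + q) = swap_poly i p + swap_poly i q"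
  by (simp add: swap_poly_def map_key_plus)

lemma swap_poly_single [simp]:
  "swap_poly i (Poly_Mapping.single m c) = Poly_Mapping.single (swap_mono i m) c"
  using map_key_single[of "swap_mono i" "swap_mono i m" c] by (simp add: swap_poly_def)

lemma swap_mono_single [simp]:
  "swap_mono i (Poly_Mapping.single v e) = Poly_Mapping.single (swap_indet i v) e"
  using map_key_single[of "swap_indet i" "swap_indet i v" e] by (simp add: swap_mono_def)

lemma swap_poly_sum: "swap_poly i (sum f A) = (\<Sum>a\<in>A. swap_poly i (f a))"
  by (induction A rule: infinite_finite_induct) (simp_all add: swap_poly_add)

lemma swap_poly_indet [simp]: "swap_poly i (indet_poly v) = indet_poly (swap_indet i v)"
  by (simp add: indet_poly_def)

lemma swap_poly_one [simp]: "swap_poly i 1 = 1"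
  by (metis map_key_zero single_one swap_mono_def inj_swap_indet swap_poly_single)

lemma poly_sum_singles:
  "(\<Sum>m\<in>Poly_Mapping.keys p. Poly_Mapping.single m (Poly_Mapping.lookup p m)) = p"
proof (rule poly_mapping_eqI)
  fix k
  show "Poly_Mapping.lookup (\<Sum>m\<in>Poly_Mapping.keys p. Poly_Mapping.single m (Poly_Mapping.lookup p m)) k
      = Poly_Mapping.lookup p k"
    by (simp add: lookup_sum lookup_single when_def in_keys_iff sum.delta')
qed

lemma swap_poly_mult: "swap_poly i (p * q) = swap_poly i p * swap_poly i q"
proof -
  let ?s = "\<lambda>p m. Poly_Mapping.single m (Poly_Mapping.lookup p m) :: polyring"
  have "swap_poly i ((\<Sum>m\<in>Poly_Mapping.keys p. ?s p m) * (\<Sum>k\<in>Poly_Mapping.keys q. ?s q k))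
      = swap_poly i (\<Sum>m\<in>Poly_Mapping.keys p. ?s p m) * swap_poly i (\<Sum>k\<in>Poly_Mapping.keys q. ?s q k)"
    by (simp only: sum_product swap_poly_sum mult_single swap_poly_single swap_mono_add)
  then show ?thesis by (simp only: poly_sum_singles)
qed

lemma swap_poly_eq_0_iff [simp]: "swap_poly i p = 0 \<longleftrightarrow> p = 0"
  by (metis swap_poly_invol swap_poly_zero)

lift_definition swap_x :: "nat \<Rightarrow> ratfun \<Rightarrow> ratfun" is
  "\<lambda>i (p, q). (swap_poly i p, swap_poly i q)"
  by (auto simp flip: swap_poly_mult)

lemma swap_x_Fract: "q \<noteq> 0 \<Longrightarrow> swap_x i (Fract p q) = Fract (swap_poly i p) (swap_poly i q)"
  by transfer simp

lemma swap_x_xvar: "swap_x i (xvar k) = xvar (transpose i (i + 1) k)"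
  by (simp add: xvar_def swap_x_Fract swap_indet_def)

lemma swap_x_yvar: "swap_x i (yvar k) = yvar k"
  by (simp add: yvar_def swap_x_Fract swap_indet_def)

lemma swap_x_tvar: "swap_x i tvar = tvar"
  by (simp add: tvar_def swap_x_Fract swap_indet_def)

lemma swap_x_add: "swap_x i (f + g) = swap_x i f + swap_x i g"
  by (cases f; cases g) (simp add: swap_x_Fract swap_poly_add swap_poly_mult)

lemma swap_x_mult: "swap_x i (f * g) = swap_x i f * swap_x i g"
  by (cases f; cases g) (simp add: swap_x_Fract swap_poly_mult)

lemma swap_x_one: "swap_x i 1 = 1"
  by (simp add: One_fract_def swap_x_Fract)

section \<open>Bruhat order on the symmetric group\<close>

text \<open>Elements of \<open>S\<^sub>n\<close> are the functions \<open>w\<close> with \<open>w permutes {1..n}\<close>.\<close>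

definition longest_perm :: "nat \<Rightarrow> nat \<Rightarrow> nat" where
  "longest_perm n i = (if i \<in> {1..n} then n + 1 - i else i)"

definition simple_refl :: "nat \<Rightarrow> nat \<Rightarrow> nat" where
  "simple_refl i = transpose i (i + 1)"

definition perm_length :: "nat \<Rightarrow> (nat \<Rightarrow> nat) \<Rightarrow> nat" where
  "perm_length n w = card {(i, j). 1 \<le> i \<and> i < j \<and> j \<le> n \<and> w j < w i}"

definition bruhat_step :: "nat \<Rightarrow> (nat \<Rightarrow> nat) \<Rightarrow> (nat \<Rightarrow> nat) \<Rightarrow> bool" where
  "bruhat_step n u v \<longleftrightarrow> u permutes {1..n} \<and>
     (\<exists>a b. 1 \<le> a \<and> a < b \<and> b \<le> n \<and> v = u \<circ> transpose a b \<and> perm_length n u < perm_length n v)"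

definition bruhat_less :: "nat \<Rightarrow> (nat \<Rightarrow> nat) \<Rightarrow> (nat \<Rightarrow> nat) \<Rightarrow> bool" where
  "bruhat_less n = (bruhat_step n)\<^sup>+\<^sup>+"

section \<open>Lifted double motivic Chern classes\<close>

definition T_op :: "nat \<Rightarrow> ratfun \<Rightarrow> ratfun" where
  "T_op i f =
     (- 1 + tvar) / (1 - inverse (xvar i / xvar (i + 1))) * f
     + (1 - tvar * (xvar i / xvar (i + 1))) / (1 - inverse (xvar i / xvar (i + 1))) * swap_x i f"

text \<open>
  Each class is the unique family on \<open>S\<^sub>n\<close> with the given initial value and recursion. The
  condition on \<^const>\<open>extensional\<close> only fixes the irrelevant values outside \<open>S\<^sub>n\<close>, so that
  the definite description can be proper.
\<close>

definition MC_X :: "nat \<Rightarrow> (nat \<Rightarrow> nat) \<Rightarrow> ratfun" where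
  "MC_X n = (THE f. f \<in> extensional {w. w permutes {1..n}} \<and>
     f id = (\<Prod>(i, j) | 1 \<le> i \<and> i < j \<and> j \<le> n. 1 - xvar i / yvar j) \<and>
     (\<forall>w i. w permutes {1..n} \<longrightarrow> 1 \<le> i \<longrightarrow> i < n \<longrightarrow>
        bruhat_less n w (w \<circ> simple_refl i) \<longrightarrow> f (w \<circ> simple_refl i) = T_op i (f w)))"

definition MC_Y :: "nat \<Rightarrow> (nat \<Rightarrow> nat) \<Rightarrow> ratfun" where
  "MC_Y n = (THE f. f \<in> extensional {w. w permutes {1..n}} \<and>
     f (longest_perm n) = (\<Prod>(i, j) | 1 \<le> i \<and> 1 \<le> j \<and> i + j \<le> n. 1 - xvar i / yvar j) \<and>
     (\<forall>w i. w permutes {1..n} \<longrightarrow> 1 \<le> i \<longrightarrow> i < n \<longrightarrow>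
        bruhat_less n (w \<circ> simple_refl i) w \<longrightarrow> f (w \<circ> simple_refl i) = T_op i (f w)))"

section \<open>The lattice model\<close>

text \<open>
  Horizontal spins: \<^term>\<open>None\<close> is the uncolored spin +, and \<^term>\<open>Some c\<close> the color c.
  Arguments of the weight: left, top, right, bottom.
\<close>

definition vertex_weight ::
  "'a::field \<Rightarrow> 'a \<Rightarrow> 'a \<Rightarrow> nat option \<Rightarrow> nat set \<Rightarrow> nat option \<Rightarrow> nat set \<Rightarrow> 'a" where
  "vertex_weight t x y L S L' S' =
    (let above = (\<lambda>c. card {a \<in> S. a > c});
         below = (\<lambda>c. card {a \<in> S. a < c});
         between = (\<lambda>c d. card {a \<in> S. c < a \<and> a < d})
     in case (L, L') of
       (None, None) \<Rightarrow> (if S' = S then (- t * x) ^ card S else 0)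
     | (None, Some c) \<Rightarrow>
         (if c \<in> S \<and> S' = S - {c}
          then (- t) ^ below c * t ^ above c * x ^ (card S - 1) else 0)
     | (Some c, None) \<Rightarrow>
         (if c \<notin> S \<and> S' = S \<union> {c}
          then (t - 1) * inverse x * (- t) ^ above c * x ^ (card S + 1) else 0)
     | (Some a, Some b) \<Rightarrow>
         (if a = b then
            (if S' = S
             then t ^ above a * x ^ card S *
                  (- inverse x + t ^ (if a \<in> S then 1 else 0) * inverse y)
             else 0)
          else if a \<notin> S \<and> b \<in> S \<and> S' = (S \<union> {a}) - {b} then
            (if a < b
             then (t - 1) * inverse x * (- t) ^ between a b * t ^ above b * x ^ card S
             else (t - 1) * inverse y * (- 1) ^ between b a * t ^ above a * x ^ card S)
          else 0))"

text \<open>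
  Rows are numbered from top to bottom, columns from right to left. The horizontal edge
  \<open>H (i, j)\<close> lies in row \<open>i\<close> immediately left of column \<open>j\<close> (so \<open>H (i, 0)\<close> is the right
  boundary edge and \<open>H (i, n)\<close> the left one); the vertical edge \<open>V (i, j)\<close> lies in column
  \<open>j\<close> immediately below row \<open>i\<close> (so \<open>V (0, j)\<close> is the top boundary edge and \<open>V (n, j)\<close>
  the bottom one).
\<close>

definition lattice_states :: "nat \<Rightarrow> (nat \<Rightarrow> nat) \<Rightarrow> (nat \<Rightarrow> nat) \<Rightarrow>
    ((nat \<times> nat \<Rightarrow> nat option) \<times> (nat \<times> nat \<Rightarrow> nat set)) set" where
  "lattice_states n \<sigma> w = {(H, V).
     H \<in> {1..n} \<times> {0..n} \<rightarrow>\<^sub>E insert None (Some ` {1..n}) \<and>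
     V \<in> {0..n} \<times> {1..n} \<rightarrow>\<^sub>E Pow {1..n} \<and>
     (\<forall>j\<in>{1..n}. V (0, j) = {\<sigma> j}) \<and> (\<forall>j\<in>{1..n}. V (n, j) = {}) \<and>
     (\<forall>i\<in>{1..n}. H (i, 0) = Some (w i)) \<and> (\<forall>i\<in>{1..n}. H (i, n) = None)}"

definition Z_square :: "nat \<Rightarrow> (nat \<Rightarrow> nat) \<Rightarrow> (nat \<Rightarrow> nat) \<Rightarrow>
    'a::field \<Rightarrow> (nat \<Rightarrow> 'a) \<Rightarrow> (nat \<Rightarrow> 'a) \<Rightarrow> 'a" where
  "Z_square n \<sigma> w t x y =
     (\<Sum>(H, V)\<in>lattice_states n \<sigma> w. \<Prod>(i, j)\<in>{1..n} \<times> {1..n}.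
        vertex_weight t (x i) (y j) (H (i, j)) (V (i - 1, j)) (H (i, j - 1)) (V (i, j)))"

text \<open>
  Sign convention. In an admissible state the color entering on top of column \<open>j\<close> makes \<open>j\<close>
  steps to the right, the last one onto the right boundary; hence exactly \<open>n choose 2\<close>
  vertices have a colored left edge, and with the above weights each of them contributes a
  sign relative to the motivic Chern classes. The two sides therefore agree up to the global
  sign \<open>(- 1) ^ (n choose 2)\<close>, independent of \<open>w\<close>. The following computation exhibits it for
  \<open>n = 2\<close>: reversing the y-variables, the partition function attached to the identity is
  minus the initial value \<open>1 - x\<^sub>1 / y\<^sub>2\<close> of \<^const>\<open>MC_X\<close>.
\<close>

lemma Z_square_2:
  fixes x y :: "nat \<Rightarrow> 'a::field"
  assumes x: "x 1 \<noteq> 0"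
  shows "Z_square 2 id (longest_perm 2) t x y = - (1 - x 1 / y 1)"
proof -
  define P where "P = (\<lambda>(H, V). \<Prod>(i, j)\<in>{1..2::nat} \<times> {1..2::nat}.
        vertex_weight t (x i) (y j) (H (i, j)) (V (i - 1, j)) (H (i, j - 1)) (V (i, j)))"
  define H0 :: "nat \<times> nat \<Rightarrow> nat option" where
    "H0 = (\<lambda>e\<in>{1..2} \<times> {0..2}. if e = (1,0) \<or> e = (1,1) then Some 2 else if e = (2,0) then Some 1 else None)"
  define V0 :: "nat \<times> nat \<Rightarrow> nat set" where
    "V0 = (\<lambda>e\<in>{0..2} \<times> {1..2}. if e = (0,1) \<or> e = (1,1) then {1} else if e = (0,2) then {2} else {})"
  have I: "{1..2::nat} = {1,2}" "{0..2::nat} = {0,1,2}" by auto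
  have PP: "P (H, V) =
      vertex_weight t (x 1) (y 1) (H (1, 1)) (V (0, 1)) (H (1, 0)) (V (1, 1)) *
      vertex_weight t (x 1) (y 2) (H (1, 2)) (V (0, 2)) (H (1, 1)) (V (1, 2)) *
      vertex_weight t (x 2) (y 1) (H (2, 1)) (V (1, 1)) (H (2, 0)) (V (2, 1)) *
      vertex_weight t (x 2) (y 2) (H (2, 2)) (V (1, 2)) (H (2, 1)) (V (2, 2))" for H V
    unfolding P_def I by (simp add: sum.cartesian_product ac_simps numeral_2_eq_2 insert_Times_insert)
  have mem: "(H0, V0) \<in> lattice_states 2 id (longest_perm 2)"
    unfolding lattice_states_def H0_def V0_def longest_perm_def I
    by (auto simp: PiE_iff extensional_def)
  have only: "(H, V) = (H0, V0)" if S: "(H, V) \<in> lattice_states 2 id (longest_perm 2)"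
    and nz: "P (H, V) \<noteq> 0" for H V
  proof -
    have b: "V (0,1) = {1}" "V (0,2) = {2}" "V (2,1) = {}" "V (2,2) = {}"
      "H (1,0) = Some 2" "H (2,0) = Some 1" "H (1,2) = None" "H (2,2) = None"
      using S unfolding lattice_states_def longest_perm_def I by auto
    have ext: "H \<in> extensional ({1..2} \<times> {0..2})" "V \<in> extensional ({0..2} \<times> {1..2})"
      using S unfolding lattice_states_def by (auto simp: PiE_iff)
    have nz': "vertex_weight t (x 1) (y 1) (H (1, 1)) {1} (Some 2) (V (1, 1)) \<noteq> 0"
      "vertex_weight t (x 1) (y 2) None {2} (H (1, 1)) (V (1, 2)) \<noteq> 0"
      "vertex_weight t (x 2) (y 1) (H (2, 1)) (V (1, 1)) (Some 1) {} \<noteq> 0"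
      "vertex_weight t (x 2) (y 2) None (V (1, 2)) (H (2, 1)) {} \<noteq> 0"
      using nz unfolding PP b by auto
    have "H (1,1) = Some 2 \<and> V (1,1) = {1}"
      using nz'(1) by (auto simp: vertex_weight_def Let_def split: option.splits if_splits)
    moreover from this have "V (1,2) = {}"
      using nz'(2) by (auto simp: vertex_weight_def Let_def split: option.splits if_splits)
    moreover from this have "H (2,1) = None"
      using nz'(4) by (auto simp: vertex_weight_def Let_def split: option.splits if_splits)
    ultimately have c: "H (1,1) = Some 2" "V (1,1) = {1}" "V (1,2) = {}" "H (2,1) = None"
      by auto
    have "H = H0"
    proof (rule extensionalityI[OF ext(1)])
      show "H0 \<in> extensional ({1..2} \<times> {0..2})" by (simp add: H0_def)
      fix e :: "nat \<times> nat" assume e: "e \<in> {1..2} \<times> {0..2}"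
      then have "e \<in> {(1,0),(1,1),(1,2),(2,0),(2,1),(2,2)}" unfolding I by auto
      then show "H e = H0 e" by (elim insertE emptyE) (use b c in \<open>simp_all add: H0_def\<close>)
    qed
    moreover have "V = V0"
    proof (rule extensionalityI[OF ext(2)])
      show "V0 \<in> extensional ({0..2} \<times> {1..2})" by (simp add: V0_def)
      fix e :: "nat \<times> nat" assume e: "e \<in> {0..2} \<times> {1..2}"
      then have "e \<in> {(0,1),(0,2),(1,1),(1,2),(2,1),(2,2)}" unfolding I by auto
      then show "V e = V0 e" by (elim insertE emptyE) (use b c in \<open>simp_all add: V0_def\<close>)
    qed
    ultimately show ?thesis by simp
  qed
  have fin: "finite (lattice_states 2 id (longest_perm 2))"
    by (rule finite_subset[of _ "({1..2} \<times> {0..2} \<rightarrow>\<^sub>E insert None (Some ` {1..2})) \<times> ({0..2} \<times> {1..2} \<rightarrow>\<^sub>E Pow {1..2})"])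
      (auto simp: lattice_states_def intro!: finite_PiE)
  have "Z_square 2 id (longest_perm 2) t x y = sum P {(H0, V0)}"
    unfolding Z_square_def P_def[symmetric]
  proof (rule sum.mono_neutral_right[OF fin])
    show "{(H0, V0)} \<subseteq> lattice_states 2 id (longest_perm 2)" using mem by blast
    show "\<forall>s\<in>lattice_states 2 id (longest_perm 2) - {(H0, V0)}. P s = 0"
      using only by auto
  qed
  also have "\<dots> = P (H0, V0)" by simp
  also have "\<dots> = - (1 - x 1 / y 1)"
  proof -
    have e: "{a. a = Suc 0 \<and> 2 < a} = {}" "{a. a = (2::nat) \<and> a < 2} = {}" "{a. a = (2::nat) \<and> 2 < a} = {}"
      "{a. a = Suc 0 \<and> Suc 0 < a} = {}" "{a. a = Suc 0 \<and> a = 0} = {}" by auto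
    show ?thesis
      unfolding PP unfolding H0_def V0_def
      using x by (simp add: vertex_weight_def Let_def e field_simps)
  qed
  finally show ?thesis .
qed

end

theory Submission
  imports Defs
begin

text \<open>
  Each family of classes is determined by one value and by the operators \<open>T\<^sub>i\<close> along the ascents
  (or descents) of permutations, because adjacent transpositions connect \<open>S\<^sub>n\<close>
  (\<open>perm_family_unique\<close>). So it suffices to show that the partition functions have the right initial
  value and satisfy the same recursion. For both families this is one statement about
  \<open>Z\<^sub>w = Z_square n id w\<close>, with arbitrary column parameters free of \<open>x\<close>: its value at \<open>w\<^sub>0\<close> and
  \<open>Z\<^sub>w\<^sub>s = T\<^sub>i Z\<^sub>w\<close> for \<open>s = s\<^sub>i\<close> and \<open>w i > w (i + 1)\<close>. Composition with \<open>w\<^sub>0\<close>, together with the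
  reversal of the column parameters, exchanges the two families.

  The recursion is the usual consequence of a Yang-Baxter equation. A matrix R on pairs of horizontal
  spins can be moved through a column of the two rows \<open>i\<close> and \<open>i + 1\<close>, at the price of exchanging
  \<open>x\<^sub>i\<close> and \<open>x\<^sub>i\<^sub>+\<^sub>1\<close> (\<open>two_row_vertex_intertwine\<close>), hence through all columns
  (\<open>path_sum_intertwine\<close>). On the uncolored left boundary R is a scalar; on the right boundary, for
  \<open>w i > w (i + 1)\<close>, it produces the two terms of \<open>T\<^sub>i\<close> with denominators cleared
  (\<open>Z_square_exchange\<close>).

  The Yang-Baxter equation has to hold for arbitrary sets of colors on the vertical edges. The
  weights are therefore split into one factor for each color that passes a vertex vertically and
  a core that sees the top set at most through a color going straight to the right
  (\<open>vertex_weight_factorization\<close>). The factor of a color that passes both rows is a product of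
  functions of the single horizontal spins, so it is the same in all terms of the equation
  (\<open>yang_baxter\<close>). What remains involves at most four colors, of which only the relative order
  matters, and is checked order by order.

  The value at \<open>w\<^sub>0\<close> comes from a single state: the color \<open>n + 1 - i\<close> goes down to row \<open>i\<close>, turns
  right and then goes straight (\<open>staircase_state_unique\<close>). On its way it crosses the columns
  \<open>j \<le> n - i\<close>, each with weight \<open>- (1 - x\<^sub>i / y\<^sub>j)\<close>, which also explains the sign
  \<open>(- 1) ^ (n choose 2)\<close> (\<open>Z_square_longest_perm\<close>).
\<close>

section \<open>Factorization of the vertex weights\<close>

text \<open>
  The contribution of a color \<open>e\<close> that goes straight down through a vertex with left spin \<open>L\<close> and
  right spin \<open>L'\<close>. That it is a function of \<open>L\<close> times a function of \<open>L'\<close> is what makes the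
  Yang-Baxter equation insensitive to such colors.
\<close>

definition crossing_factor :: "'a::field \<Rightarrow> 'a \<Rightarrow> nat option \<Rightarrow> nat option \<Rightarrow> nat \<Rightarrow> 'a" where
  "crossing_factor t x L L' e =
     x * (case L of None \<Rightarrow> - t | Some c \<Rightarrow> if c < e then - t else 1)
       * (case L' of None \<Rightarrow> 1 | Some d \<Rightarrow> if d < e then - 1 else 1)"

text \<open>
  What remains of a weight once all crossings are split off, multiplied by \<open>x\<close> so that
  \<open>inverse x\<close> does not occur. The remainder depends on the top set only through the membership
  of a color that goes straight from left to right.
\<close>

definition core_weight :: "'a::field \<Rightarrow> 'a \<Rightarrow> 'a \<Rightarrow> nat set \<Rightarrow> nat option \<Rightarrow> nat option \<Rightarrow> 'a" where
  "core_weight t x y S L L' = (case (L, L') of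
     (None, _) \<Rightarrow> x
   | (Some c, None) \<Rightarrow> (t - 1) * x
   | (Some c, Some d) \<Rightarrow>
       if c = d then x * inverse y * (if c \<in> S then t else 1) - 1
       else if c < d then (t - 1) * x else (t - 1) * x * x * inverse y)"

text \<open>
  A color that turns down must not yet be present on top, and a color that turns right must be
  present there. The bottom set is then determined by the other three spins.
\<close>

definition admissible :: "nat set \<Rightarrow> nat option \<Rightarrow> nat option \<Rightarrow> bool" where
  "admissible S L L' \<longleftrightarrow> L = L' \<or> set_option L \<inter> S = {} \<and> set_option L' \<subseteq> S"

definition below_set :: "nat set \<Rightarrow> nat option \<Rightarrow> nat option \<Rightarrow> nat set" where
  "below_set S L L' = (if L = L' then S else (S - set_option L') \<union> set_option L)"

definition crossed_set :: "nat set \<Rightarrow> nat option \<Rightarrow> nat option \<Rightarrow> nat set" where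
  "crossed_set S L L' = (if L = L' then S else S - set_option L')"

text \<open>
  Up to the factor \<open>inverse x\<close>, the vertex weight as a function of the left, top and right spins
  alone.
\<close>

definition reduced_weight :: "'a::field \<Rightarrow> 'a \<Rightarrow> 'a \<Rightarrow> nat set \<Rightarrow> nat option \<Rightarrow> nat option \<Rightarrow> 'a" where
  "reduced_weight t x y S L L' = (if admissible S L L'
     then core_weight t x y S L L' * prod (crossing_factor t x L L') (crossed_set S L L') else 0)"

lemma prod_if_one: "finite S \<Longrightarrow> (\<Prod>e\<in>S. if P e then k else 1) = k ^ card {e \<in> S. P e}"
  for k :: "'a::comm_monoid_mult"
  by (simp add: prod.If_cases Int_def)

lemma prod_crossing_factor:
  assumes "finite S"
  shows "prod (crossing_factor t x L L') S = x ^ card S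
    * (case L of None \<Rightarrow> (- t) ^ card S | Some c \<Rightarrow> (- t) ^ card {e \<in> S. c < e})
    * (case L' of None \<Rightarrow> 1 | Some d \<Rightarrow> (- 1) ^ card {e \<in> S. d < e})"
  using assms unfolding crossing_factor_def prod.distrib
  by (cases L; cases L') (simp_all add: prod_if_one)

lemma card_interval_split:
  fixes c d :: nat
  assumes "finite S" "c < d" "d \<in> S"
  shows "card {e \<in> S - {d}. c < e} = card {e \<in> S. c < e \<and> e < d} + card {e \<in> S. d < e}"
proof -
  have "{e \<in> S - {d}. c < e} = {e \<in> S. c < e \<and> e < d} \<union> {e \<in> S. d < e}"
    using assms(2) by auto
  then show ?thesis using assms by (simp add: card_Un_disjoint disjoint_iff)
qed

lemma card_interval_split':
  fixes c d :: nat
  assumes "finite S" "c < d" "d \<notin> S"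
  shows "card {e \<in> S. c < e} = card {e \<in> S. c < e \<and> e < d} + card {e \<in> S. d < e}"
proof -
  have "{e \<in> S. c < e} = {e \<in> S. c < e \<and> e < d} \<union> {e \<in> S. d < e}"
    using assms(2,3) by (auto simp: not_less_iff_gr_or_eq)
  then show ?thesis using assms by (simp add: card_Un_disjoint disjoint_iff)
qed

lemma card_split_at:
  fixes c :: nat
  assumes "finite S" "c \<in> S"
  shows "card S = Suc (card {e \<in> S. e < c} + card {e \<in> S. c < e})"
proof -
  have "S = insert c ({e \<in> S. e < c} \<union> {e \<in> S. c < e})" using assms(2) by auto
  then have "card S = card (insert c ({e \<in> S. e < c} \<union> {e \<in> S. c < e}))" by simp
  then show ?thesis using assms by (simp add: card_Un_disjoint disjoint_iff)
qed

text \<open>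
  The powers of \<open>- t\<close>, \<open>t\<close>, \<open>- 1\<close> and \<open>x\<close> in the weights are products over the crossed colors. A
  crossed color that exceeds the left color contributes \<open>- t\<close>, and one that exceeds the right color
  contributes \<open>- 1\<close>. So a color that exceeds both contributes \<open>t\<close>, and a color strictly between
  them \<open>- t\<close> or \<open>- 1\<close>, depending on which side has the smaller color. Here an uncolored left
  spin counts as smaller than all colors, and an uncolored right spin as larger.
\<close>

lemma vertex_weight_factorization:
  assumes x: "x \<noteq> 0" and S: "finite S"
  shows "vertex_weight t x y L S L' S' =
    (if S' = below_set S L L' then inverse x * reduced_weight t x y S L L' else 0)"
proof -
  have sign: "(- t) ^ k = (- 1) ^ k * t ^ k" for k by (rule power_minus)
  have sq: "(- 1) ^ k * (- 1) ^ k = (1 :: 'a)" "(- 1) ^ k * ((- 1) ^ k * z) = (z :: 'a)" for k z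
    by (simp_all flip: power_mult_distrib mult.assoc)
  have cancel: "inverse x * (x * z) = z" "x * (inverse x * z) = z" for z
    using x by (simp_all flip: mult.assoc)
  note eval = vertex_weight_def reduced_weight_def core_weight_def admissible_def
    below_set_def crossed_set_def prod_crossing_factor[OF S] Let_def
  show ?thesis
  proof (cases L; cases L')
    assume "L = None" "L' = None"
    moreover have "(- (t * x)) ^ card S = (- t) ^ card S * x ^ card S"
      by (simp flip: power_mult_distrib)
    ultimately show ?thesis by (simp add: eval cancel mult.commute)
  next
    fix d assume L: "L = None" "L' = Some d"
    have "{e \<in> S - {d}. d < e} = {e \<in> S. d < e}" by auto
    moreover have "card S = Suc (card {e \<in> S. e < d} + card {e \<in> S. d < e})" if "d \<in> S"
      using card_split_at[OF S that] .
    ultimately show ?thesis using L S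
      by (simp add: eval prod_crossing_factor cancel sign sq power_add mult_ac)
  next
    fix c assume L: "L = Some c" "L' = None"
    then show ?thesis by (simp add: eval cancel mult_ac)
  next
    fix c d assume L: "L = Some c" "L' = Some d"
    consider "c = d" | "c < d" | "d < c" by linarith
    then show ?thesis
    proof cases
      case 1
      have diag: "inverse x * ((x * inverse y * u - 1) * z) = (u * inverse y - inverse x) * z" for u z
      proof -
        have "inverse x * x = 1" using x by simp
        then show ?thesis by algebra
      qed
      have diag1: "inverse x * ((x * inverse y - 1) * z) = (inverse y - inverse x) * z" for z
        using diag[of 1 z] by (simp only: mult_1_left mult_1_right)
      have "prod (crossing_factor t x (Some d) (Some d)) S = x ^ card S * t ^ card {e \<in> S. d < e}"
        by (simp add: prod_crossing_factor[OF S] sign sq mult_ac)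
      then show ?thesis unfolding L 1
        by (cases "d \<in> S";
            simp add: vertex_weight_def reduced_weight_def core_weight_def admissible_def
              below_set_def crossed_set_def Let_def diag diag1;
            simp add: mult_ac)
    next
      case 2
      show ?thesis
      proof (cases "d \<in> S")
        case True
        have m: "card S = Suc (card (S - {d}))" using S True by (rule card.remove)
        have power: "x ^ card S = x * x ^ card (S - {d})" unfolding m power_Suc ..
        have above: "{e \<in> S - {d}. d < e} = {e \<in> S. d < e}" by auto
        have "prod (crossing_factor t x (Some c) (Some d)) (S - {d})
            = x ^ card (S - {d}) * (- t) ^ card {e \<in> S. c < e \<and> e < d} * t ^ card {e \<in> S. d < e}"
          unfolding prod_crossing_factor[OF finite_Diff[OF S]] option.case
            card_interval_split[OF S 2 True] above by (simp add: power_add sign sq mult_ac)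
        then show ?thesis using 2 True x unfolding L
          by (simp add: vertex_weight_def reduced_weight_def core_weight_def admissible_def
              below_set_def crossed_set_def Let_def insert_Diff_if power cancel mult_ac del: card_Diff_insert card_Diff_singleton)
      qed (use 2 L in \<open>simp add: eval\<close>)
    next
      case 3
      show ?thesis
      proof (cases "d \<in> S \<and> c \<notin> S")
        case True
        then have m: "card S = Suc (card (S - {d}))" using S by (intro card.remove) auto
        have power: "x ^ card S = x * x ^ card (S - {d})" unfolding m power_Suc ..
        have above: "{e \<in> S - {d}. d < e} = {e \<in> S. d < e}" "{e \<in> S - {d}. c < e} = {e \<in> S. c < e}"
          using 3 by auto
        have "prod (crossing_factor t x (Some c) (Some d)) (S - {d})
            = x ^ card (S - {d}) * t ^ card {e \<in> S. c < e} * (- 1) ^ card {e \<in> S. d < e \<and> e < c}"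
          unfolding prod_crossing_factor[OF finite_Diff[OF S]] option.case above
            card_interval_split'[OF S 3 conjunct2[OF True]] by (simp add: power_add sign sq mult_ac)
        then show ?thesis using 3 True x unfolding L
          by (simp add: vertex_weight_def reduced_weight_def core_weight_def admissible_def
              below_set_def crossed_set_def Let_def insert_Diff_if power cancel mult_ac del: card_Diff_insert card_Diff_singleton)
      qed (use 3 L in \<open>auto simp: eval\<close>)
    qed
  qed
qed

section \<open>The Yang-Baxter equation for two rows\<close>

lemma crossing_factor_simps:
  "crossing_factor t x None None e = - t * x"
  "crossing_factor t x None (Some d) e = (if d < e then t * x else - t * x)"
  "crossing_factor t x (Some c) None e = (if c < e then - t * x else x)"
  "crossing_factor t x (Some c) (Some d) e =
     (if c < e then if d < e then t * x else - t * x else if d < e then - x else x)"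
  by (simp_all add: crossing_factor_def)

lemma reduced_weight_simps:
  "reduced_weight t x y S None None = x * prod (crossing_factor t x None None) S"
  "reduced_weight t x y S None (Some d) =
     (if d \<in> S then x * prod (crossing_factor t x None (Some d)) (S - {d}) else 0)"
  "reduced_weight t x y S (Some c) None =
     (if c \<in> S then 0 else (t - 1) * x * prod (crossing_factor t x (Some c) None) S)"
  "reduced_weight t x y S (Some c) (Some d) =
     (if c = d
      then (x * inverse y * (if c \<in> S then t else 1) - 1) * prod (crossing_factor t x (Some c) (Some c)) S
      else if c \<in> S \<or> d \<notin> S then 0
      else (if c < d then (t - 1) * x else (t - 1) * x * x * inverse y)
        * prod (crossing_factor t x (Some c) (Some d)) (S - {d}))"
  by (auto simp add: reduced_weight_def core_weight_def admissible_def crossed_set_def)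

lemma below_set_simps:
  "below_set S None None = S"
  "below_set S None (Some d) = S - {d}"
  "below_set S (Some c) None = insert c S"
  "below_set S (Some c) (Some d) = (if c = d then S else insert c (S - {d}))"
  by (auto simp add: below_set_def)

text \<open>
  Entries of the R-matrix for rows with parameters \<open>x1\<close> above \<open>x2\<close>: \<open>R_diag a b\<close> keeps the pair
  of spins \<open>(a, b)\<close>, and \<open>R_swap a b\<close> replaces it by \<open>(b, a)\<close>. Into a pair of colors \<open>(p, q)\<close> with
  \<open>p > q\<close> lead the entries \<open>(1 - t) * x1 * x2\<close> and \<open>x2 * (x1 - x2)\<close>, which together with the entry
  at the uncolored pair are the coefficients of the operator \<open>T\<^sub>i\<close> after clearing denominators. The
  entries for \<open>p < q\<close> follow by exchanging \<open>x1\<close> and \<open>x2\<close> and solving, and those with an uncolored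
  or a repeated spin are forced by the smallest instances of the Yang-Baxter equation.
\<close>

definition R_diag :: "'a::field \<Rightarrow> 'a \<Rightarrow> 'a \<Rightarrow> nat option \<Rightarrow> nat option \<Rightarrow> 'a" where
  "R_diag t x1 x2 a b = (case (a, b) of
     (None, None) \<Rightarrow> x1 * (x2 - t * x1)
   | (Some c, Some d) \<Rightarrow>
       if c = d then x2 * (x1 - t * x2)
       else if c < d then (1 - t) * x2 * x2 else (1 - t) * x1 * x2
   | _ \<Rightarrow> (1 - t) * x1 * x2)"

definition R_swap :: "'a::field \<Rightarrow> 'a \<Rightarrow> 'a \<Rightarrow> nat option \<Rightarrow> nat option \<Rightarrow> 'a" where
  "R_swap t x1 x2 a b = (case (a, b) of
     (None, None) \<Rightarrow> 0
   | (None, Some d) \<Rightarrow> x1 - x2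
   | (Some c, None) \<Rightarrow> t * x1 * x2 * (x1 - x2)
   | (Some c, Some d) \<Rightarrow>
       if c = d then 0 else if c < d then x2 * (x1 - x2) else t * x2 * (x1 - x2))"

lemma R_simps:
  "R_diag t x1 x2 None None = x1 * (x2 - t * x1)"
  "R_diag t x1 x2 None (Some d) = (1 - t) * x1 * x2"
  "R_diag t x1 x2 (Some c) None = (1 - t) * x1 * x2"
  "R_diag t x1 x2 (Some c) (Some d) =
     (if c = d then x2 * (x1 - t * x2)
      else if c < d then (1 - t) * x2 * x2 else (1 - t) * x1 * x2)"
  "R_swap t x1 x2 None None = 0"
  "R_swap t x1 x2 None (Some d) = x1 - x2"
  "R_swap t x1 x2 (Some c) None = t * x1 * x2 * (x1 - x2)"
  "R_swap t x1 x2 (Some c) (Some d) =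
     (if c = d then 0 else if c < d then x2 * (x1 - x2) else t * x2 * (x1 - x2))"
  by (simp_all add: R_diag_def R_swap_def)

lemma R_swap_same [simp]: "R_swap t x1 x2 a a = 0"
  by (cases a) (simp_all add: R_simps)

text \<open>
  Two vertices above each other, without their factors \<open>inverse x1\<close> and \<open>inverse x2\<close>; the left spins
  are \<open>a\<close>, \<open>b\<close> and the right spins \<open>c\<close>, \<open>d\<close>, from top to bottom.
\<close>

definition two_row_weight :: "'a::field \<Rightarrow> 'a \<Rightarrow> 'a \<Rightarrow> 'a \<Rightarrow> nat set \<Rightarrow>
    nat option \<Rightarrow> nat option \<Rightarrow> nat option \<Rightarrow> nat option \<Rightarrow> 'a" where
  "two_row_weight t x1 x2 y S a b c d =
     reduced_weight t x1 y S a c * reduced_weight t x2 y (below_set S a c) b d"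

text \<open>
  The Yang-Baxter equation, with R on the left of a column with exchanged parameters on one side
  and on the right of the original column on the other. The spin between the two rows and the
  bottom spin are left implicit, as they are determined by the spins shown.
\<close>

definition yang_baxter :: "'a::field \<Rightarrow> 'a \<Rightarrow> 'a \<Rightarrow> 'a \<Rightarrow> nat set \<Rightarrow>
    nat option \<Rightarrow> nat option \<Rightarrow> nat option \<Rightarrow> nat option \<Rightarrow> bool" where
  "yang_baxter t x1 x2 y S a b c d \<longleftrightarrow>
     R_diag t x1 x2 a b * two_row_weight t x2 x1 y S a b c d
     + R_swap t x1 x2 a b * two_row_weight t x2 x1 y S b a c d
   = two_row_weight t x1 x2 y S a b c d * R_diag t x1 x2 c d
     + two_row_weight t x1 x2 y S a b d c * R_swap t x1 x2 d c"

text \<open>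
  Each case lists all consequences for the comparison of \<open>p\<close> with \<open>q\<close>, so that the simplifier can
  evaluate weights by rewriting with premises, without arithmetic.
\<close>

lemma three_way_cases:
  fixes p q :: nat
  obtains "p < q" "\<not> q < p" "p \<noteq> q" "q \<noteq> p" | "p = q" | "q < p" "\<not> p < q" "p \<noteq> q" "q \<noteq> p"
  by (metis linorder_less_linear order_less_asym)

text \<open>
  The equation for top sets without spectators. A color that leaves on the right without entering
  on the left must come from the top, and a color that enters on the left without leaving on the
  right must not be there; only the presence of colors on both sides, collected in \<open>T\<close>, is free.
\<close>

definition yang_baxter_reduced :: "'a::field \<Rightarrow> 'a \<Rightarrow> 'a \<Rightarrow> 'a \<Rightarrow>
    nat option \<Rightarrow> nat option \<Rightarrow> nat option \<Rightarrow> nat option \<Rightarrow> bool" where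
  "yang_baxter_reduced t x1 x2 y a b c d \<longleftrightarrow>
    (\<forall>T \<in> Pow ((set_option a \<union> set_option b) \<inter> (set_option c \<union> set_option d)).
       yang_baxter t x1 x2 y (T \<union> ((set_option c \<union> set_option d) - (set_option a \<union> set_option b))) a b c d)"

lemmas yang_baxter_eval = yang_baxter_def two_row_weight_def
  crossing_factor_simps reduced_weight_simps below_set_simps R_simps
  insert_Diff_if prod.insert_if algebra_simps

text \<open>
  The finite check, sorted by the number of colored spins: as the weights depend only on the
  relative order of the colors, each order turns the equation into a polynomial identity in
  \<open>t\<close>, \<open>x1\<close>, \<open>x2\<close> and \<open>inverse y\<close>. The arithmetic procedures of the simplifier are switched off
  because the comparisons present as premises already decide all conditions.
\<close>

lemma yang_baxter_no_color: "yang_baxter_reduced t x1 x2 y None None None None"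
  unfolding yang_baxter_reduced_def by (simp add: yang_baxter_eval)

lemma yang_baxter_one_color:
  "yang_baxter_reduced t x1 x2 y (Some p) None None None"
  "yang_baxter_reduced t x1 x2 y None (Some p) None None"
  "yang_baxter_reduced t x1 x2 y None None (Some p) None"
  "yang_baxter_reduced t x1 x2 y None None None (Some p)"
  unfolding yang_baxter_reduced_def by (simp_all add: yang_baxter_eval)

lemma yang_baxter_two_colors:
  "yang_baxter_reduced t x1 x2 y (Some p) (Some q) None None"
  "yang_baxter_reduced t x1 x2 y (Some p) None (Some q) None"
  "yang_baxter_reduced t x1 x2 y (Some p) None None (Some q)"
  "yang_baxter_reduced t x1 x2 y None (Some p) (Some q) None"
  "yang_baxter_reduced t x1 x2 y None (Some p) None (Some q)"
  "yang_baxter_reduced t x1 x2 y None None (Some p) (Some q)"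
  unfolding yang_baxter_reduced_def
  supply [[simproc del: fast_arith_nat fast_arith, linarith_neq_limit = 0]]
  by (cases p q rule: three_way_cases; rule ballI; simp add: Pow_insert insert_Diff_if; (elim disjE)?;
      simp add: yang_baxter_eval)+

lemma yang_baxter_three_colors:
  "yang_baxter_reduced t x1 x2 y (Some p) (Some q) (Some r) None"
  "yang_baxter_reduced t x1 x2 y (Some p) (Some q) None (Some r)"
  "yang_baxter_reduced t x1 x2 y (Some p) None (Some q) (Some r)"
  "yang_baxter_reduced t x1 x2 y None (Some p) (Some q) (Some r)"
  unfolding yang_baxter_reduced_def
  supply [[simproc del: fast_arith_nat fast_arith, linarith_neq_limit = 0]]
  by (cases p q rule: three_way_cases; cases p r rule: three_way_cases;
      cases q r rule: three_way_cases; (linarith)?;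
      rule ballI; simp add: Pow_insert insert_Diff_if; (elim disjE)?;
      simp add: yang_baxter_eval)+

lemma yang_baxter_four_colors:
  "yang_baxter_reduced t x1 x2 y (Some p) (Some q) (Some r) (Some s)"
  unfolding yang_baxter_reduced_def
  supply [[simproc del: fast_arith_nat fast_arith, linarith_neq_limit = 0]]
  by (cases p q rule: three_way_cases; cases p r rule: three_way_cases;
      cases q r rule: three_way_cases; (linarith)?; cases p s rule: three_way_cases; (linarith)?;
      cases q s rule: three_way_cases; (linarith)?; cases r s rule: three_way_cases; (linarith)?;
      rule ballI; simp add: Pow_insert insert_Diff_if; (elim disjE)?;
      simp add: yang_baxter_eval)

lemma yang_baxter_reduced: "yang_baxter_reduced t x1 x2 y a b c d"
  by (cases a; cases b; cases c; cases d)
    (simp_all add: yang_baxter_no_color yang_baxter_one_color yang_baxter_two_colors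
      yang_baxter_three_colors yang_baxter_four_colors)

definition spins :: "nat \<Rightarrow> nat option set" where
  "spins n = insert None (Some ` {1..n})"

lemma finite_spins [simp]: "finite (spins n)"
  and None_in_spins [simp]: "None \<in> spins n"
  and Some_in_spins [simp]: "Some c \<in> spins n \<longleftrightarrow> c \<in> {1..n}"
  by (auto simp: spins_def)

lemmas lattice_states_alt = lattice_states_def[folded spins_def]

text \<open>
  The partition function of two vertices above each other, with the vertical spin between them
  summed over.
\<close>

definition two_row_vertex :: "nat \<Rightarrow> 'a::field \<Rightarrow> 'a \<Rightarrow> 'a \<Rightarrow> 'a \<Rightarrow> nat set \<Rightarrow> nat set \<Rightarrow>
    nat option \<times> nat option \<Rightarrow> nat option \<times> nat option \<Rightarrow> 'a" where
  "two_row_vertex n t x1 x2 y S S' l r =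
     (\<Sum>U\<in>Pow {1..n}. vertex_weight t x1 y (fst l) S (fst r) U * vertex_weight t x2 y (snd l) U (snd r) S')"

text \<open>
  Colors in \<open>E\<close> are spectators: they differ from all spins at the vertex and are crossed.
\<close>

lemma reduced_weight_spectators:
  assumes "finite E" "finite R" "E \<inter> (R \<union> set_option L \<union> set_option L') = {}"
  shows "reduced_weight t x y (E \<union> R) L L' = prod (crossing_factor t x L L') E * reduced_weight t x y R L L'"
    and "below_set (E \<union> R) L L' = E \<union> below_set R L L'"
proof -
  have "crossed_set (E \<union> R) L L' = E \<union> crossed_set R L L'" "finite (crossed_set R L L')"
    "E \<inter> crossed_set R L L' = {}"
    using assms by (auto simp: crossed_set_def)
  then have "prod (crossing_factor t x L L') (crossed_set (E \<union> R) L L')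
      = prod (crossing_factor t x L L') E * prod (crossing_factor t x L L') (crossed_set R L L')"
    using assms(1) by (simp add: prod.union_disjoint)
  moreover have "admissible (E \<union> R) L L' = admissible R L L'"
    using assms(3) by (auto simp: admissible_def)
  moreover have "core_weight t x y (E \<union> R) L L' = core_weight t x y R L L'"
    using assms(3) by (auto simp: core_weight_def split: option.split)
  ultimately show "reduced_weight t x y (E \<union> R) L L'
      = prod (crossing_factor t x L L') E * reduced_weight t x y R L L'"
    by (simp add: reduced_weight_def)
  show "below_set (E \<union> R) L L' = E \<union> below_set R L L'"
    using assms(3) by (auto simp: below_set_def)
qed

lemma two_row_weight_spectators:
  assumes "finite E" "finite R"
    "E \<inter> (R \<union> set_option a \<union> set_option b \<union> set_option c \<union> set_option d) = {}"
  shows "two_row_weight t x1 x2 y (E \<union> R) a b c d =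
    (\<Prod>e\<in>E. crossing_factor t x1 a c e * crossing_factor t x2 b d e) * two_row_weight t x1 x2 y R a b c d"
proof -
  have first: "E \<inter> (R \<union> set_option a \<union> set_option c) = {}"
    and second: "E \<inter> (below_set R a c \<union> set_option b \<union> set_option d) = {}"
    and fin: "finite (below_set R a c)"
    using assms by (auto simp: below_set_def)
  show ?thesis
    by (simp add: two_row_weight_def reduced_weight_spectators[OF assms(1,2) first]
        reduced_weight_spectators(1)[OF assms(1) fin second] prod.distrib)
qed

text \<open>
  Color conservation: outside these conditions all four terms of the Yang-Baxter equation vanish.
\<close>

lemma two_row_weight_nonzero:
  assumes "two_row_weight t x1 x2 y S a b c d \<noteq> 0"
  shows "S \<inter> (set_option a \<union> set_option b) \<subseteq> set_option c \<union> set_option d"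
    and "(set_option c \<union> set_option d) - (set_option a \<union> set_option b) \<subseteq> S"
proof -
  have "admissible S a c" "admissible (below_set S a c) b d"
    using assms by (auto simp: two_row_weight_def reduced_weight_def split: if_splits)
  then show "S \<inter> (set_option a \<union> set_option b) \<subseteq> set_option c \<union> set_option d"
    and "(set_option c \<union> set_option d) - (set_option a \<union> set_option b) \<subseteq> S"
    by (auto simp: admissible_def below_set_def split: if_splits)
qed

text \<open>
  The spectators contribute the same factor to all four terms: for one color it is a product of a
  function of each of the two left spins and of each of the two right spins, and hence symmetric
  in both pairs. Cancelling it leaves the reduced equation.
\<close>

lemma yang_baxter:
  assumes S: "finite S"
  shows "yang_baxter t x1 x2 y S a b c d"
proof (cases "S \<inter> (set_option a \<union> set_option b) \<subseteq> set_option c \<union> set_option d \<and>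
    (set_option c \<union> set_option d) - (set_option a \<union> set_option b) \<subseteq> S")
  case False
  then have "two_row_weight t x x' y S a b c d = 0" "two_row_weight t x x' y S b a c d = 0"
    "two_row_weight t x x' y S a b d c = 0" for x x'
    using two_row_weight_nonzero[of t x x' y S a b c d] two_row_weight_nonzero[of t x x' y S b a c d]
      two_row_weight_nonzero[of t x x' y S a b d c] by (auto simp: Un_commute)
  then show ?thesis by (simp add: yang_baxter_def)
next
  case True
  let ?in = "set_option a \<union> set_option b" and ?out = "set_option c \<union> set_option d"
  define E where "E = S - (?in \<union> ?out)"
  define R where "R = (S \<inter> (?in \<inter> ?out)) \<union> (?out - ?in)"
  have S_eq: "S = E \<union> R" using True unfolding E_def R_def by blast
  have E: "finite E" "finite R" "E \<inter> (R \<union> set_option a \<union> set_option b \<union> set_option c \<union> set_option d) = {}"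
    using S unfolding E_def R_def by auto
  have E': "E \<inter> (R \<union> set_option b \<union> set_option a \<union> set_option c \<union> set_option d) = {}"
    "E \<inter> (R \<union> set_option a \<union> set_option b \<union> set_option d \<union> set_option c) = {}"
    using E(3) by blast+
  \<comment> \<open>The common factor of the spectators in all four terms.\<close>
  let ?P = "\<Prod>e\<in>E. crossing_factor t x1 a c e * crossing_factor t x2 b d e"
  have exchange:
    "crossing_factor t x2 a c e * crossing_factor t x1 b d e = crossing_factor t x1 a c e * crossing_factor t x2 b d e"
    "crossing_factor t x2 b c e * crossing_factor t x1 a d e = crossing_factor t x1 a c e * crossing_factor t x2 b d e"
    "crossing_factor t x1 a d e * crossing_factor t x2 b c e = crossing_factor t x1 a c e * crossing_factor t x2 b d e"
    for e by (simp_all add: crossing_factor_def mult_ac)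
  have factor: "two_row_weight t x2 x1 y S a b c d = ?P * two_row_weight t x2 x1 y R a b c d"
    "two_row_weight t x2 x1 y S b a c d = ?P * two_row_weight t x2 x1 y R b a c d"
    "two_row_weight t x1 x2 y S a b c d = ?P * two_row_weight t x1 x2 y R a b c d"
    "two_row_weight t x1 x2 y S a b d c = ?P * two_row_weight t x1 x2 y R a b d c"
    unfolding S_eq two_row_weight_spectators[OF E] two_row_weight_spectators[OF E(1,2) E'(1)]
      two_row_weight_spectators[OF E(1,2) E'(2)] exchange by simp_all
  have "yang_baxter t x1 x2 y R a b c d"
    using yang_baxter_reduced[of t x1 x2 y a b c d] unfolding yang_baxter_reduced_def R_def by blast
  then have "?P * (R_diag t x1 x2 a b * two_row_weight t x2 x1 y R a b c d
       + R_swap t x1 x2 a b * two_row_weight t x2 x1 y R b a c d)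
     = ?P * (two_row_weight t x1 x2 y R a b c d * R_diag t x1 x2 c d
       + two_row_weight t x1 x2 y R a b d c * R_swap t x1 x2 d c)"
    by (simp add: yang_baxter_def)
  then show ?thesis
    unfolding yang_baxter_def factor by (simp add: distrib_left mult_ac)
qed

text \<open>
  The colors that remain below two rows, by counting: those that enter more often than they leave
  on the right. In this form the set is visibly symmetric in \<open>a\<close>, \<open>b\<close> and in \<open>c\<close>, \<open>d\<close>, so all terms
  of the Yang-Baxter equation have the same bottom set.
\<close>

definition final_set :: "nat set \<Rightarrow> nat option \<Rightarrow> nat option \<Rightarrow> nat option \<Rightarrow> nat option \<Rightarrow> nat set" where
  "final_set S a b c d = {e. of_bool (c = Some e) + of_bool (d = Some e)
     < of_bool (e \<in> S) + of_bool (a = Some e) + (of_bool (b = Some e) :: nat)}"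

lemma final_set_commute:
  "final_set S b a c d = final_set S a b c d" "final_set S a b d c = final_set S a b c d"
  by (simp_all add: final_set_def add_ac)

lemma color_conservation:
  assumes "admissible S L L'"
  shows "of_bool (e \<in> S) + of_bool (L = Some e)
    = of_bool (e \<in> below_set S L L') + (of_bool (L' = Some e) :: nat)"
  using assms by (cases L; cases L') (auto simp: admissible_def below_set_def split: if_splits)

lemma below_set_twice:
  assumes "admissible S a c" "admissible (below_set S a c) b d"
  shows "below_set (below_set S a c) b d = final_set S a b c d"
proof (rule set_eqI)
  fix e
  show "e \<in> below_set (below_set S a c) b d \<longleftrightarrow> e \<in> final_set S a b c d"
    using color_conservation[OF assms(1), of e] color_conservation[OF assms(2), of e]
    by (cases "e \<in> below_set (below_set S a c) b d") (simp_all add: final_set_def)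
qed

text \<open>
  The sum over the inner vertical spin has at most one nonzero term, by color conservation.
\<close>

lemma two_row_vertex_eq:
  assumes x: "x1 \<noteq> 0" "x2 \<noteq> 0" and S: "S \<subseteq> {1..n}" and a: "a \<in> spins n"
  shows "two_row_vertex n t x1 x2 y S S' (a, b) (c, d) =
    (if S' = final_set S a b c d then inverse x1 * inverse x2 * two_row_weight t x1 x2 y S a b c d else 0)"
proof -
  let ?U = "below_set S a c"
  have fin: "finite S" using S finite_subset by blast
  have U: "?U \<in> Pow {1..n}" using S a by (auto simp: below_set_def spins_def)
  then have finU: "finite ?U" using finite_subset by blast
  have "two_row_vertex n t x1 x2 y S S' (a, b) (c, d) =
      (\<Sum>U\<in>Pow {1..n}. if U = ?U then
         vertex_weight t x1 y a S c ?U * vertex_weight t x2 y b ?U d S' else 0)"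
    unfolding two_row_vertex_def fst_conv snd_conv
    by (intro sum.cong) (auto simp: vertex_weight_factorization[OF x(1) fin])
  also have "\<dots> = vertex_weight t x1 y a S c ?U * vertex_weight t x2 y b ?U d S'"
    using U by simp
  also have "\<dots> = (if S' = below_set ?U b d
      then inverse x1 * inverse x2 * two_row_weight t x1 x2 y S a b c d else 0)"
    by (simp add: vertex_weight_factorization[OF x(1) fin] vertex_weight_factorization[OF x(2) finU]
        two_row_weight_def mult_ac)
  also have "\<dots> = (if S' = final_set S a b c d
      then inverse x1 * inverse x2 * two_row_weight t x1 x2 y S a b c d else 0)"
  proof (cases "two_row_weight t x1 x2 y S a b c d = 0")
    case False
    then have "admissible S a c" "admissible ?U b d"
      by (auto simp: two_row_weight_def reduced_weight_def split: if_splits)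
    then show ?thesis by (simp add: below_set_twice)
  qed simp
  finally show ?thesis .
qed

text \<open>
  R as a matrix on pairs of spins. The two summands overlap only at pairs of equal spins, where
  \<open>R_swap\<close> vanishes.
\<close>

definition R_entry :: "'a::field \<Rightarrow> 'a \<Rightarrow> 'a \<Rightarrow>
    nat option \<times> nat option \<Rightarrow> nat option \<times> nat option \<Rightarrow> 'a" where
  "R_entry t x1 x2 l m =
     (if m = l then R_diag t x1 x2 (fst l) (snd l) else 0)
     + (if m = prod.swap l then R_swap t x1 x2 (fst l) (snd l) else 0)"

lemma sum_R_entry_left:
  assumes "finite X" "a \<in> X" "b \<in> X"
  shows "(\<Sum>m\<in>X \<times> X. R_entry t x1 x2 (a, b) m * f m)
    = R_diag t x1 x2 a b * f (a, b) + R_swap t x1 x2 a b * f (b, a)"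
proof -
  have "R_entry t x1 x2 (a, b) m * f m = (if m = (a, b) then R_diag t x1 x2 a b * f (a, b) else 0)
      + (if m = (b, a) then R_swap t x1 x2 a b * f (b, a) else 0)" for m
    by (cases "a = b"; auto simp: R_entry_def distrib_right)
  then have "(\<Sum>m\<in>X \<times> X. R_entry t x1 x2 (a, b) m * f m)
      = (\<Sum>m\<in>X \<times> X. if m = (a, b) then R_diag t x1 x2 a b * f (a, b) else 0)
        + (\<Sum>m\<in>X \<times> X. if m = (b, a) then R_swap t x1 x2 a b * f (b, a) else 0)"
    by (simp only: sum.distrib)
  then show ?thesis
    using assms by (simp only: sum.delta finite_cartesian_product mem_Times_iff fst_conv snd_conv) simp
qed

lemma sum_R_entry_right:
  assumes "finite X" "c \<in> X" "d \<in> X"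
  shows "(\<Sum>m\<in>X \<times> X. f m * R_entry t x1 x2 m (c, d))
    = f (c, d) * R_diag t x1 x2 c d + f (d, c) * R_swap t x1 x2 d c"
proof -
  have swap: "(c, d) = prod.swap m \<longleftrightarrow> m = (d, c)" for m
    by (cases m) auto
  have "f m * R_entry t x1 x2 m (c, d) = (if m = (c, d) then f (c, d) * R_diag t x1 x2 c d else 0)
      + (if m = (d, c) then f (d, c) * R_swap t x1 x2 d c else 0)" for m
    unfolding R_entry_def swap by (cases "c = d"; auto simp: distrib_left)
  then have "(\<Sum>m\<in>X \<times> X. f m * R_entry t x1 x2 m (c, d))
      = (\<Sum>m\<in>X \<times> X. if m = (c, d) then f (c, d) * R_diag t x1 x2 c d else 0)
        + (\<Sum>m\<in>X \<times> X. if m = (d, c) then f (d, c) * R_swap t x1 x2 d c else 0)"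
    by (simp only: sum.distrib)
  then show ?thesis
    using assms by (simp only: sum.delta finite_cartesian_product mem_Times_iff fst_conv snd_conv) simp
qed

text \<open>
  The Yang-Baxter equation in matrix form, \<open>R * K' = K * R\<close>, where \<open>K'\<close> is the column \<open>K\<close> with the
  parameters of its two rows exchanged.
\<close>

lemma two_row_vertex_intertwine:
  assumes x: "x1 \<noteq> 0" "x2 \<noteq> 0" and S: "S \<subseteq> {1..n}"
    and l: "l \<in> spins n \<times> spins n" and r: "r \<in> spins n \<times> spins n"
  shows "(\<Sum>m\<in>spins n \<times> spins n. R_entry t x1 x2 l m * two_row_vertex n t x2 x1 y S S' m r)
       = (\<Sum>m\<in>spins n \<times> spins n. two_row_vertex n t x1 x2 y S S' l m * R_entry t x1 x2 m r)"
proof -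
  obtain a b where ab: "l = (a, b)" "a \<in> spins n" "b \<in> spins n" using l by auto
  obtain c d where cd: "r = (c, d)" "c \<in> spins n" "d \<in> spins n" using r by auto
  let ?k = "inverse x1 * inverse x2"
  \<comment> \<open>The factor \<open>?k\<close> is the one split off from the vertex weights, the same for both orders of the rows.\<close>
  have "?k * (R_diag t x1 x2 a b * two_row_weight t x2 x1 y S a b c d
       + R_swap t x1 x2 a b * two_row_weight t x2 x1 y S b a c d)
     = ?k * (two_row_weight t x1 x2 y S a b c d * R_diag t x1 x2 c d
       + two_row_weight t x1 x2 y S a b d c * R_swap t x1 x2 d c)"
    using yang_baxter[OF finite_subset[OF S], of t x1 x2 y a b c d] by (simp add: yang_baxter_def)
  then show ?thesis
    unfolding ab cd sum_R_entry_left[OF finite_spins ab(2,3)] sum_R_entry_right[OF finite_spins cd(2,3)]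
      two_row_vertex_eq[OF x S ab(2)] two_row_vertex_eq[OF x(2,1) S ab(2)] two_row_vertex_eq[OF x(2,1) S ab(3)]
      final_set_commute(1)[of S b a] final_set_commute(2)[of S a b d c]
    by (simp add: distrib_left mult_ac)
qed

section \<open>Sums over paths and the strip of two rows\<close>

text \<open>
  The entry \<open>(l, r)\<close> of the matrix product \<open>K n * \<dots> * K 1\<close>. Columns are numbered from right to
  left, so the leftmost factor belongs to column \<open>n\<close>.
\<close>

fun path_sum :: "(nat \<Rightarrow> 'b \<Rightarrow> 'b \<Rightarrow> 'a::comm_semiring_1) \<Rightarrow> 'b set \<Rightarrow> nat \<Rightarrow> 'b \<Rightarrow> 'b \<Rightarrow> 'a" where
  "path_sum K X 0 l r = (if l = r then 1 else 0)"
| "path_sum K X (Suc n) l r = (\<Sum>m\<in>X. K (Suc n) l m * path_sum K X n m r)"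

lemma path_sum_eq_sum_paths:
  assumes X: "finite X" "r \<in> X" and l: "l \<in> X"
  shows "(\<Sum>s | s \<in> {0..n} \<rightarrow>\<^sub>E X \<and> s 0 = r \<and> s n = l. \<Prod>j\<in>{1..n}. K j (s j) (s (j - 1)))
       = path_sum K X n l r"
  using l
proof (induction n arbitrary: l)
  case 0
  have "{s. s \<in> {0..0} \<rightarrow>\<^sub>E X \<and> s 0 = r \<and> s 0 = l} = (if l = r then {\<lambda>k\<in>{0..0::nat}. r} else {})"
    using X by (auto simp: PiE_iff extensional_def fun_eq_iff)
  then show ?case by simp
next
  case (Suc n)
  let ?paths = "\<lambda>n l. {s. s \<in> {0..n} \<rightarrow>\<^sub>E X \<and> s 0 = r \<and> s n = l}"
  let ?f = "\<lambda>n s. \<Prod>j\<in>{1..n}. K j (s j) (s (j - 1))"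
  have step: "?f (Suc n) (s(Suc n := l)) = K (Suc n) l (s n) * ?f n s" for s
  proof -
    have "(\<Prod>j\<in>{1..n}. K j ((s(Suc n := l)) j) ((s(Suc n := l)) (j - 1))) = ?f n s"
      by (intro prod.cong) auto
    then show ?thesis by (simp add: mult.commute)
  qed
  have "sum (?f (Suc n)) (?paths (Suc n) l) = (\<Sum>(m, s)\<in>Sigma X (?paths n). K (Suc n) l m * ?f n s)"
  proof (rule sum.reindex_bij_witness
      [where i = "\<lambda>(m, s). s(Suc n := l)" and j = "\<lambda>s. (s n, restrict s {0..n})"])
    fix s assume s: "s \<in> ?paths (Suc n) l"
    show eq: "(case (s n, restrict s {0..n}) of (m, s) \<Rightarrow> s(Suc n := l)) = s"
      using s by (auto simp: fun_eq_iff PiE_iff extensional_def)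
    show "(s n, restrict s {0..n}) \<in> Sigma X (?paths n)"
      using s by (auto simp: PiE_iff extensional_def)
    show "(case (s n, restrict s {0..n}) of (m, s) \<Rightarrow> K (Suc n) l m * ?f n s) = ?f (Suc n) s"
      using eq step[of "restrict s {0..n}"] by simp
  next
    fix p assume p: "p \<in> Sigma X (?paths n)"
    obtain m s where ms: "p = (m, s)" "m \<in> X" "s \<in> ?paths n m" using p by auto
    show "((case p of (m, s) \<Rightarrow> s(Suc n := l)) n, restrict (case p of (m, s) \<Rightarrow> s(Suc n := l)) {0..n}) = p"
      using ms by (auto simp: fun_eq_iff PiE_iff extensional_def)
    show "(case p of (m, s) \<Rightarrow> s(Suc n := l)) \<in> ?paths (Suc n) l"
      using ms Suc.prems by (auto simp: PiE_iff extensional_def)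
  qed
  also have "\<dots> = (\<Sum>m\<in>X. \<Sum>s\<in>?paths n m. K (Suc n) l m * ?f n s)"
    by (subst sum.Sigma) (use X in \<open>auto intro: finite_subset[of _ "{0..n} \<rightarrow>\<^sub>E X"] finite_PiE\<close>)
  also have "\<dots> = path_sum K X (Suc n) l r"
    using Suc.IH by (simp flip: sum_distrib_left)
  finally show ?case .
qed

text \<open>
  A matrix that can be moved through every single column can be moved through all of them.
\<close>

lemma path_sum_intertwine:
  assumes CK: "\<And>j l r. 1 \<le> j \<Longrightarrow> j \<le> n \<Longrightarrow> l \<in> X \<Longrightarrow> r \<in> X \<Longrightarrow> (\<Sum>m\<in>X. C l m * K' j m r) = (\<Sum>m\<in>X. K j l m * C m r)"
    and X: "finite X" and lr: "l \<in> X" "r \<in> X"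
  shows "(\<Sum>m\<in>X. C l m * path_sum K' X n m r) = (\<Sum>m\<in>X. path_sum K X n l m * C m r)"
  using CK lr(1)
proof (induction n arbitrary: l)
  case 0
  then show ?case using X lr(2) by (simp add: if_distrib[of "\<lambda>z. C l _ * z"] if_distrib[of "\<lambda>z. z * C _ r"] cong: if_cong)
next
  case (Suc n)
  have IH: "(\<Sum>k\<in>X. C m k * path_sum K' X n k r) = (\<Sum>k\<in>X. path_sum K X n m k * C k r)" if "m \<in> X" for m
    by (rule Suc.IH) (use Suc.prems that in auto)
  have "(\<Sum>m\<in>X. C l m * path_sum K' X (Suc n) m r)
      = (\<Sum>k\<in>X. (\<Sum>m\<in>X. C l m * K' (Suc n) m k) * path_sum K' X n k r)"
    by (simp add: sum_distrib_left sum_distrib_right mult.assoc) (rule sum.swap)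
  also have "\<dots> = (\<Sum>k\<in>X. (\<Sum>m\<in>X. K (Suc n) l m * C m k) * path_sum K' X n k r)"
    using Suc.prems by simp
  also have "\<dots> = (\<Sum>m\<in>X. K (Suc n) l m * (\<Sum>k\<in>X. C m k * path_sum K' X n k r))"
    by (simp add: sum_distrib_left sum_distrib_right mult.assoc) (rule sum.swap)
  also have "\<dots> = (\<Sum>m\<in>X. K (Suc n) l m * (\<Sum>k\<in>X. path_sum K X n m k * C k r))"
    using IH by simp
  also have "\<dots> = (\<Sum>k\<in>X. path_sum K X (Suc n) l k * C k r)"
    by (simp add: sum_distrib_left sum_distrib_right mult.assoc) (rule sum.swap)
  finally show ?case .
qed

text \<open>
  States of the lattice with the horizontal edges of the rows \<open>i\<close> and \<open>i + 1\<close> and the vertical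
  edges between these rows removed. They do not see \<open>w i\<close> and \<open>w (i + 1)\<close>.
\<close>

definition outer_states :: "nat \<Rightarrow> (nat \<Rightarrow> nat) \<Rightarrow> (nat \<Rightarrow> nat) \<Rightarrow> nat \<Rightarrow>
    ((nat \<times> nat \<Rightarrow> nat option) \<times> (nat \<times> nat \<Rightarrow> nat set)) set" where
  "outer_states n \<sigma> w i = {(H, V).
     H \<in> ({1..n} - {i, Suc i}) \<times> {0..n} \<rightarrow>\<^sub>E spins n \<and>
     V \<in> ({0..n} - {i}) \<times> {1..n} \<rightarrow>\<^sub>E Pow {1..n} \<and>
     (\<forall>j\<in>{1..n}. V (0, j) = {\<sigma> j}) \<and> (\<forall>j\<in>{1..n}. V (n, j) = {}) \<and>
     (\<forall>k\<in>{1..n} - {i, Suc i}. H (k, 0) = Some (w k) \<and> H (k, n) = None)}"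

definition outer_weight :: "nat \<Rightarrow> 'a::field \<Rightarrow> (nat \<Rightarrow> 'a) \<Rightarrow> (nat \<Rightarrow> 'a) \<Rightarrow> nat \<Rightarrow>
    (nat \<times> nat \<Rightarrow> nat option) \<times> (nat \<times> nat \<Rightarrow> nat set) \<Rightarrow> 'a" where
  "outer_weight n t x y i = (\<lambda>(H, V). \<Prod>(k, j)\<in>({1..n} - {i, Suc i}) \<times> {1..n}.
     vertex_weight t (x k) (y j) (H (k, j)) (V (k - 1, j)) (H (k, j - 1)) (V (k, j)))"

text \<open>
  Fixing all other spins, the edges inside the rows \<open>i\<close> and \<open>i + 1\<close> form a strip whose partition
  function is a product of two-row columns. Only this factor involves \<open>w i\<close>, \<open>w (i + 1)\<close> and the
  parameters of these two rows.
\<close>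

lemma Z_square_two_rows:
  assumes i: "1 \<le> i" "i < n" and w: "w i \<in> {1..n}" "w (Suc i) \<in> {1..n}"
  shows "Z_square n \<sigma> w t x y =
    (\<Sum>(H, V)\<in>outer_states n \<sigma> w i. outer_weight n t x y i (H, V) *
       path_sum (\<lambda>j. two_row_vertex n t (x i) (x (Suc i)) (y j) (V (i - 1, j)) (V (Suc i, j)))
         (spins n \<times> spins n) n (None, None) (Some (w i), Some (w (Suc i))))"
proof -
  let ?P = "{1..n} \<rightarrow>\<^sub>E Pow {1..n}"
  let ?X = "spins n \<times> spins n"
  let ?l = "(None, None)" and ?r = "(Some (w i), Some (w (Suc i)))"
  define paths where "paths = {s. s \<in> {0..n} \<rightarrow>\<^sub>E ?X \<and> s 0 = ?r \<and> s n = ?l}"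
  define vw where "vw k j L S R S' = vertex_weight t (x k) (y j) L S R S'" for k j L S R S'
  define strip where "strip V s m = (\<Prod>j\<in>{1..n}.
      vw i j (fst (s j)) (V (i - 1, j)) (fst (s (j - 1))) (m j) *
      vw (Suc i) j (snd (s j)) (m j) (snd (s (j - 1))) (V (Suc i, j)))"
    for V :: "nat \<times> nat \<Rightarrow> nat set" and s :: "nat \<Rightarrow> nat option \<times> nat option" and m
  \<comment> \<open>\<open>s\<close> collects the pairs of horizontal spins and \<open>m\<close> the vertical spins between the two rows.\<close>
  have strip_sum: "(\<Sum>(s, m)\<in>paths \<times> ?P. strip V s m) =
      path_sum (\<lambda>j. two_row_vertex n t (x i) (x (Suc i)) (y j) (V (i - 1, j)) (V (Suc i, j))) ?X n ?l ?r" for V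
  proof -
    have "(\<Sum>(s, m)\<in>paths \<times> ?P. strip V s m) = (\<Sum>s\<in>paths. \<Sum>m\<in>?P. strip V s m)"
      by (simp add: sum.cartesian_product)
    also have "\<dots> = (\<Sum>s\<in>paths. \<Prod>j\<in>{1..n}. two_row_vertex n t (x i) (x (Suc i)) (y j) (V (i - 1, j)) (V (Suc i, j)) (s j) (s (j - 1)))"
      unfolding strip_def two_row_vertex_def vw_def by (subst prod_sum_PiE) simp_all
    also have "\<dots> = path_sum (\<lambda>j. two_row_vertex n t (x i) (x (Suc i)) (y j) (V (i - 1, j)) (V (Suc i, j))) ?X n ?l ?r"
      unfolding paths_def by (rule path_sum_eq_sum_paths) (use w in auto)
    finally show ?thesis .
  qed
  define glueH where "glueH H s = (\<lambda>(k, j)\<in>{1..n} \<times> {0..n}.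
      if k = i then fst (s j) else if k = Suc i then snd (s j) else H (k, j))"
    for H :: "nat \<times> nat \<Rightarrow> nat option" and s :: "nat \<Rightarrow> nat option \<times> nat option"
  define glueV where "glueV V m = (\<lambda>(k, j)\<in>{0..n} \<times> {1..n}. if k = i then m j else V (k, j))"
    for V :: "nat \<times> nat \<Rightarrow> nat set" and m
  \<comment> \<open>Mutually inverse passages between states and pairs of an outer state and a filling of the strip.\<close>
  define glue where "glue = (\<lambda>((H, V), (s, m)). (glueH H s, glueV V m))"
  define cut where "cut = (\<lambda>(H :: nat \<times> nat \<Rightarrow> nat option, V :: nat \<times> nat \<Rightarrow> nat set).
      ((restrict H (({1..n} - {i, Suc i}) \<times> {0..n}), restrict V (({0..n} - {i}) \<times> {1..n})),
       (\<lambda>j\<in>{0..n}. (H (i, j), H (Suc i, j)), \<lambda>j\<in>{1..n}. V (i, j))))"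
  let ?w = "\<lambda>H V k j. vw k j (H (k, j)) (V (k - 1, j)) (H (k, j - 1)) (V (k, j))"
  have weight: "(\<Prod>(k, j)\<in>{1..n} \<times> {1..n}. ?w (glueH H s) (glueV V m) k j)
      = outer_weight n t x y i (H, V) * strip V s m" for H V s m
  proof -
    have outer_eq: "?w (glueH H s) (glueV V m) k j = ?w H V k j"
      if "k \<in> {1..n}" "k \<noteq> i" "k \<noteq> Suc i" "j \<in> {1..n}" for k j
    proof -
      have "k - Suc 0 \<noteq> i" using that by auto
      then show ?thesis using that by (auto simp: glueH_def glueV_def)
    qed
    have "(\<Prod>(k, j)\<in>{1..n} \<times> {1..n}. ?w (glueH H s) (glueV V m) k j)
        = (\<Prod>k\<in>{1..n}. \<Prod>j\<in>{1..n}. ?w (glueH H s) (glueV V m) k j)"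
      by (simp add: prod.cartesian_product)
    also have "\<dots> = (\<Prod>k\<in>{1..n} - {i, Suc i}. \<Prod>j\<in>{1..n}. ?w (glueH H s) (glueV V m) k j)
        * (\<Prod>k\<in>{i, Suc i}. \<Prod>j\<in>{1..n}. ?w (glueH H s) (glueV V m) k j)"
      by (rule prod.subset_diff) (use i in auto)
    also have "(\<Prod>k\<in>{i, Suc i}. \<Prod>j\<in>{1..n}. ?w (glueH H s) (glueV V m) k j) = strip V s m"
      unfolding strip_def using i
      by (auto simp: prod.distrib glueH_def glueV_def intro!: arg_cong2[where f = times] prod.cong)
    also have "(\<Prod>k\<in>{1..n} - {i, Suc i}. \<Prod>j\<in>{1..n}. ?w (glueH H s) (glueV V m) k j) = outer_weight n t x y i (H, V)"
      unfolding outer_weight_def prod.cartesian_product split_conv vw_def[symmetric]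
    proof (rule prod.cong[OF refl])
      fix p assume "p \<in> ({1..n} - {i, Suc i}) \<times> {1..n}"
      then show "(case p of (k, j) \<Rightarrow> ?w (glueH H s) (glueV V m) k j) = (case p of (k, j) \<Rightarrow> ?w H V k j)"
        by (cases p) (simp add: outer_eq[simplified])
    qed
    finally show ?thesis .
  qed
  have "Z_square n \<sigma> w t x y = (\<Sum>(H, V)\<in>lattice_states n \<sigma> w. \<Prod>(k, j)\<in>{1..n} \<times> {1..n}. ?w H V k j)"
    by (simp add: Z_square_def vw_def)
  also have "\<dots> = (\<Sum>p\<in>outer_states n \<sigma> w i \<times> (paths \<times> ?P).
      (\<lambda>(H, V). \<Prod>(k, j)\<in>{1..n} \<times> {1..n}. ?w H V k j) (glue p))"
  proof (rule sum.reindex_bij_witness[where i = glue and j = cut])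
    fix q assume q: "q \<in> lattice_states n \<sigma> w"
    obtain H V where HV_eq: "q = (H, V)" by (cases q)
    have HV: "(H, V) \<in> lattice_states n \<sigma> w" using q HV_eq by simp
    let ?H = "restrict H (({1..n} - {i, Suc i}) \<times> {0..n})" and ?V = "restrict V (({0..n} - {i}) \<times> {1..n})"
    let ?s = "\<lambda>j\<in>{0..n}. (H (i, j), H (Suc i, j))" and ?m = "\<lambda>j\<in>{1..n}. V (i, j)"
    have ext: "H \<in> {1..n} \<times> {0..n} \<rightarrow>\<^sub>E spins n" "V \<in> {0..n} \<times> {1..n} \<rightarrow>\<^sub>E Pow {1..n}"
      using HV by (auto simp: lattice_states_alt)
    have H: "glueH ?H ?s = H"
      using ext(1) i by (auto simp: glueH_def fun_eq_iff PiE_iff extensional_def)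
    have V: "glueV ?V ?m = V"
      using ext(2) i by (auto simp: glueV_def fun_eq_iff PiE_iff extensional_def)
    have Hs: "H (k, j) \<in> spins n" if "k \<in> {1..n}" "j \<in> {0..n}" for k j
      using ext(1) that by blast
    have Vs: "V (k, j) \<in> Pow {1..n}" if "k \<in> {0..n}" "j \<in> {1..n}" for k j
      using ext(2) that by blast
    have HV_outer: "(?H, ?V) \<in> outer_states n \<sigma> w i"
      using HV i unfolding outer_states_def lattice_states_alt by (auto intro!: PiE_I dest: PiE_mem)
    have "?s \<in> {0..n} \<rightarrow>\<^sub>E ?X"
    proof (rule PiE_I)
      fix j assume j: "j \<in> {0..n}"
      have "H (i, j) \<in> spins n" "H (Suc i, j) \<in> spins n"
        by (rule Hs; use i j in simp)+
      then show "?s j \<in> ?X" using j by simp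
    qed simp
    then have s: "?s \<in> paths" using HV i unfolding paths_def lattice_states_alt by simp
    have m: "?m \<in> ?P" using Vs i by (auto intro!: PiE_I)
    show glue_cut: "glue (cut q) = q" using H V by (simp add: glue_def cut_def HV_eq)
    show "cut q \<in> outer_states n \<sigma> w i \<times> (paths \<times> ?P)"
      using HV_outer s m by (simp add: cut_def HV_eq)
    show "(\<lambda>(H, V). \<Prod>(k, j)\<in>{1..n} \<times> {1..n}. ?w H V k j) (glue (cut q))
        = (\<lambda>(H, V). \<Prod>(k, j)\<in>{1..n} \<times> {1..n}. ?w H V k j) q"
      unfolding glue_cut ..
  next
    fix p assume "p \<in> outer_states n \<sigma> w i \<times> (paths \<times> ?P)"
    then obtain H V s m where p: "p = ((H, V), (s, m))"
      and HV: "(H, V) \<in> outer_states n \<sigma> w i" and s: "s \<in> paths" and m: "m \<in> ?P"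
      by auto
    have ext: "H \<in> ({1..n} - {i, Suc i}) \<times> {0..n} \<rightarrow>\<^sub>E spins n" "V \<in> ({0..n} - {i}) \<times> {1..n} \<rightarrow>\<^sub>E Pow {1..n}"
      "s \<in> {0..n} \<rightarrow>\<^sub>E ?X"
      using HV s by (auto simp: outer_states_def paths_def)
    have "restrict (glueH H s) (({1..n} - {i, Suc i}) \<times> {0..n}) = H"
      using ext(1) by (auto simp: glueH_def fun_eq_iff PiE_iff extensional_def)
    moreover have "restrict (glueV V m) (({0..n} - {i}) \<times> {1..n}) = V"
      using ext(2) by (auto simp: glueV_def fun_eq_iff PiE_iff extensional_def)
    moreover have "(\<lambda>j\<in>{0..n}. (glueH H s (i, j), glueH H s (Suc i, j))) = s"
      using ext(3) i by (auto simp: glueH_def fun_eq_iff PiE_iff extensional_def)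
    moreover have "(\<lambda>j\<in>{1..n}. glueV V m (i, j)) = m"
      using m i by (auto simp: glueV_def fun_eq_iff PiE_iff extensional_def)
    ultimately show "cut (glue p) = p" by (simp add: cut_def glue_def p)
    have Hs: "H (k, j) \<in> spins n" if "k \<in> {1..n} - {i, Suc i}" "j \<in> {0..n}" for k j
      using ext(1) that by blast
    have Vs: "V (k, j) \<in> Pow {1..n}" if "k \<in> {0..n} - {i}" "j \<in> {1..n}" for k j
      using ext(2) that by blast
    have ss: "fst (s j) \<in> spins n" "snd (s j) \<in> spins n" if "j \<in> {0..n}" for j
      using PiE_mem[OF ext(3) that] by (auto simp: mem_Times_iff)
    have ms: "m j \<in> Pow {1..n}" if "j \<in> {1..n}" for j
      using m that by blast
    have "glueH H s \<in> {1..n} \<times> {0..n} \<rightarrow>\<^sub>E spins n"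
      using Hs ss unfolding glueH_def by (intro PiE_I) (auto split: if_splits)
    moreover have "glueV V m \<in> {0..n} \<times> {1..n} \<rightarrow>\<^sub>E Pow {1..n}"
    proof (rule PiE_I)
      fix e assume "e \<in> {0..n} \<times> {1..n}"
      then show "glueV V m e \<in> Pow {1..n}"
        using Vs[of "fst e" "snd e"] ms[of "snd e"] by (cases e) (simp add: glueV_def split: if_splits)
    qed (simp add: glueV_def)
    moreover have "glueH H s (k, 0) = Some (w k)" "glueH H s (k, n) = None" if "k \<in> {1..n}" for k
      using HV s that by (auto simp: glueH_def outer_states_def paths_def)
    moreover have "glueV V m (0, j) = {\<sigma> j}" "glueV V m (n, j) = {}" if "j \<in> {1..n}" for j
      using HV i that by (auto simp: glueV_def outer_states_def)
    ultimately show "glue p \<in> lattice_states n \<sigma> w"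
      unfolding lattice_states_alt glue_def p by simp
  qed
  also have "\<dots> = (\<Sum>((H, V), (s, m))\<in>outer_states n \<sigma> w i \<times> (paths \<times> ?P).
      outer_weight n t x y i (H, V) * strip V s m)"
  proof (rule sum.cong[OF refl], goal_cases)
    case (1 p)
    obtain H V s m where p: "p = ((H, V), (s, m))" by (metis surj_pair)
    show ?case
      unfolding p glue_def split_conv by (rule weight)
  qed
  also have "\<dots> = (\<Sum>(H, V)\<in>outer_states n \<sigma> w i. outer_weight n t x y i (H, V) *
      (\<Sum>(s, m)\<in>paths \<times> ?P. strip V s m))"
    by (simp only: sum.cartesian_product' split_conv case_prod_unfold fst_conv snd_conv sum_distrib_left prod.collapse)
  finally show ?thesis unfolding strip_sum .
qed

section \<open>Adjacent transpositions and the Bruhat order\<close>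

lemma simple_refl_simps [simp]:
  "simple_refl i i = Suc i" "simple_refl i (Suc i) = i"
  "k \<noteq> i \<Longrightarrow> k \<noteq> Suc i \<Longrightarrow> simple_refl i k = k" "simple_refl i (simple_refl i k) = k"
  by (simp_all add: simple_refl_def)

lemma simple_refl_permutes: "1 \<le> i \<Longrightarrow> i < n \<Longrightarrow> simple_refl i permutes {1..n}"
  by (simp add: simple_refl_def permutes_swap_id)

lemma comp_simple_refl_permutes:
  "w permutes {1..n} \<Longrightarrow> 1 \<le> i \<Longrightarrow> i < n \<Longrightarrow> w \<circ> simple_refl i permutes {1..n}"
  using permutes_compose simple_refl_permutes by blast

lemma comp_simple_refl_invol: "w \<circ> simple_refl i \<circ> simple_refl i = w"
  by (simp add: fun_eq_iff)

lemma simple_refl_mono: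
  "k < l \<Longrightarrow> \<not> (k = i \<and> l = Suc i) \<Longrightarrow> simple_refl i k < simple_refl i l"
  by (auto simp: simple_refl_def transpose_def)

text \<open>
  Exchanging the positions \<open>i\<close> and \<open>i + 1\<close> maps the inversions of \<open>w\<close> injectively to those of
  \<open>w \<circ> simple_refl i\<close>, and misses the new inversion \<open>(i, i + 1)\<close>.
\<close>

lemma perm_length_ascent:
  assumes i: "1 \<le> i" "i < n" and up: "w i < w (Suc i)"
  shows "perm_length n w < perm_length n (w \<circ> simple_refl i)"
proof -
  let ?inv = "\<lambda>w. {(k, l). 1 \<le> k \<and> k < l \<and> l \<le> n \<and> w l < (w k :: nat)}"
  let ?s = "simple_refl i"
  have fin: "finite (?inv (w \<circ> ?s))"
    by (rule finite_subset[of _ "{1..n} \<times> {1..n}"]) auto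
  have range: "1 \<le> ?s k" "?s k \<le> n" if "1 \<le> k" "k \<le> n" for k
    using that i by (auto simp: simple_refl_def transpose_def)
  have "(i, Suc i) \<in> ?inv (w \<circ> ?s)" using i up by simp
  moreover have "(i, Suc i) \<notin> map_prod ?s ?s ` ?inv w"
  proof
    assume "(i, Suc i) \<in> map_prod ?s ?s ` ?inv w"
    then obtain k l where "i = ?s k" "Suc i = ?s l" "k < l" by (elim imageE) auto
    then have "k = Suc i" "l = i" by (metis simple_refl_simps(1,2,4))+
    then show False using \<open>k < l\<close> by simp
  qed
  moreover have "map_prod ?s ?s ` ?inv w \<subseteq> ?inv (w \<circ> ?s)"
    using range up by (auto intro!: simple_refl_mono)
  ultimately have "map_prod ?s ?s ` ?inv w \<subset> ?inv (w \<circ> ?s)" by blast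
  then have "card (map_prod ?s ?s ` ?inv w) < card (?inv (w \<circ> ?s))"
    using fin psubset_card_mono by blast
  moreover have "inj (map_prod ?s ?s)"
    by (intro prod.inj_map) (metis injI simple_refl_simps(4))+
  ultimately show ?thesis
    by (simp add: perm_length_def card_image inj_on_subset)
qed

lemma bruhat_less_perm_length: "bruhat_less n u v \<Longrightarrow> perm_length n u < perm_length n v"
proof -
  have step: "perm_length n u < perm_length n v" if "bruhat_step n u v" for u v
    using that by (auto simp add: bruhat_step_def)
  show "bruhat_less n u v \<Longrightarrow> perm_length n u < perm_length n v"
    unfolding bruhat_less_def
    by (induction rule: tranclp_induct) (auto dest: step)
qed

text \<open>
  For elements that differ by an adjacent transposition on the right, the Bruhat order is decided
  by the length, as every Bruhat step increases it.
\<close>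

lemma bruhat_less_simple_refl_iff:
  assumes w: "w permutes {1..n}" and i: "1 \<le> i" "i < n"
  shows "bruhat_less n w (w \<circ> simple_refl i) \<longleftrightarrow> w i < w (Suc i)"
proof
  assume less: "bruhat_less n w (w \<circ> simple_refl i)"
  have "w i \<noteq> w (Suc i)" using permutes_inj[OF w] by (simp add: inj_eq)
  moreover have "\<not> w (Suc i) < w i"
    using perm_length_ascent[OF i, of "w \<circ> simple_refl i"] bruhat_less_perm_length[OF less]
    by (auto simp: comp_simple_refl_invol)
  ultimately show "w i < w (Suc i)" by simp
next
  assume "w i < w (Suc i)"
  from perm_length_ascent[OF i this] have "bruhat_step n w (w \<circ> simple_refl i)"
    unfolding bruhat_step_def using w i
    by (intro conjI exI[of _ i] exI[of _ "Suc i"]) (simp_all add: simple_refl_def)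
  then show "bruhat_less n w (w \<circ> simple_refl i)" by (simp add: bruhat_less_def)
qed

lemma bruhat_greater_simple_refl_iff:
  assumes w: "w permutes {1..n}" and i: "1 \<le> i" "i < n"
  shows "bruhat_less n (w \<circ> simple_refl i) w \<longleftrightarrow> w (Suc i) < w i"
  using bruhat_less_simple_refl_iff[OF comp_simple_refl_permutes[OF w i] i]
  by (simp add: comp_simple_refl_invol)

lemma no_descent_imp_id:
  assumes w: "w permutes {1..n}" and asc: "\<And>i. 1 \<le> i \<Longrightarrow> i < n \<Longrightarrow> w i < w (Suc i)"
  shows "w = id"
proof -
  \<comment> \<open>An increasing bijection of \<open>{1..n}\<close> neither drops below nor rises above the identity.\<close>
  have ge: "k \<le> w k" if "1 \<le> k" "k \<le> n" for k
    using that
  proof (induction k rule: dec_induct)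
    case base
    then show ?case using permutes_in_image[OF w, of 1] by auto
  next
    case (step k)
    then show ?case using asc[of k] by simp
  qed
  have "w k = k" if "1 \<le> k" "k \<le> n" for k
    using that(2,1)
  proof (induction k rule: inc_induct)
    case base
    then show ?case using ge[of n] permutes_in_image[OF w, of n] by auto
  next
    case (step k)
    then show ?case using asc[of k] ge[of k] by simp
  qed
  then show ?thesis using permutes_not_in[OF w] by (auto simp: fun_eq_iff)
qed

text \<open>
  Sorting by adjacent transpositions leads from every permutation down to the identity, so values
  propagate from the identity to all of \<open>S\<^sub>n\<close>.
\<close>

lemma perm_family_unique:
  assumes base: "f id = g id"
    and f: "\<And>w i. w permutes {1..n} \<Longrightarrow> 1 \<le> i \<Longrightarrow> i < n \<Longrightarrow> w i < w (Suc i) \<Longrightarrow>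
      f (w \<circ> simple_refl i) = T i (f w)"
    and g: "\<And>w i. w permutes {1..n} \<Longrightarrow> 1 \<le> i \<Longrightarrow> i < n \<Longrightarrow> w i < w (Suc i) \<Longrightarrow>
      g (w \<circ> simple_refl i) = T i (g w)"
    and w: "w permutes {1..n}"
  shows "f w = g w"
  using w
proof (induction "perm_length n w" arbitrary: w rule: less_induct)
  case less
  show ?case
  proof (cases "\<exists>i\<ge>1. i < n \<and> w (Suc i) < w i")
    case False
    have "w i < w (Suc i)" if "1 \<le> i" "i < n" for i
      using False that permutes_inj[OF less.prems] by (metis inj_eq linorder_neqE_nat n_not_Suc_n)
    then show ?thesis using no_descent_imp_id[OF less.prems] base by blast
  next
    case True
    then obtain i where i: "1 \<le> i" "i < n" and down: "w (Suc i) < w i" by blast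
    let ?u = "w \<circ> simple_refl i"
    have u: "?u permutes {1..n}" and up: "?u i < ?u (Suc i)"
      using comp_simple_refl_permutes[OF less.prems i] down by simp_all
    have "perm_length n ?u < perm_length n w"
      using perm_length_ascent[OF i, of ?u] up by (simp add: comp_simple_refl_invol)
    then show ?thesis
      using f[of ?u, OF u i up] g[of ?u, OF u i up] less.hyps[OF _ u]
      by (simp add: comp_simple_refl_invol)
  qed
qed

section \<open>Exchange of two adjacent rows\<close>

text \<open>
  Moving R through the strip from left to right. On the left boundary both spins are uncolored, and
  R acts there by the scalar \<open>x i * (x (Suc i) - t * x i)\<close>; on the right boundary it mixes the
  boundary conditions \<open>w\<close> and \<open>w \<circ> simple_refl i\<close>.
\<close>

lemma Z_square_exchange:
  fixes x y :: "nat \<Rightarrow> 'a::field"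
  assumes w: "w permutes {1..n}" and i: "1 \<le> i" "i < n" and desc: "w (Suc i) < w i"
    and x: "x i \<noteq> 0" "x (Suc i) \<noteq> 0"
  shows "x i * (x (Suc i) - t * x i) * Z_square n \<sigma> w t (x \<circ> transpose i (Suc i)) y
    = Z_square n \<sigma> w t x y * ((1 - t) * x i * x (Suc i))
      + Z_square n \<sigma> (w \<circ> simple_refl i) t x y * (x (Suc i) * (x i - x (Suc i)))"
proof -
  let ?p = "w i" and ?q = "w (Suc i)" and ?x' = "x \<circ> transpose i (Suc i)"
  let ?X = "spins n \<times> spins n"
  have pq: "?p \<in> {1..n}" "?q \<in> {1..n}" using permutes_in_image[OF w] i by simp_all
  define strip where "strip V x1 x2 =
      path_sum (\<lambda>j. two_row_vertex n t x1 x2 (y j) (V (i - 1, j)) (V (Suc i, j))) ?X n (None, None)"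
    for V :: "nat \<times> nat \<Rightarrow> nat set" and x1 x2
  have outer: "outer_states n \<sigma> (w \<circ> simple_refl i) i = outer_states n \<sigma> w i"
    unfolding outer_states_def by auto
  have outer_wt: "outer_weight n t ?x' y i HV = outer_weight n t x y i HV" for HV
  proof -
    have "?x' (fst p) = x (fst p)" if "p \<in> ({1..n} - {i, Suc i}) \<times> {1..n}" for p
      using that by (auto simp: transpose_def)
    then show ?thesis
      unfolding outer_weight_def case_prod_unfold by (intro prod.cong refl) (simp only:)
  qed
  have Z: "Z_square n \<sigma> w t x y =
      (\<Sum>(H, V)\<in>outer_states n \<sigma> w i. outer_weight n t x y i (H, V) * strip V (x i) (x (Suc i)) (Some ?p, Some ?q))"
    unfolding strip_def using Z_square_two_rows[OF i pq] .
  have Z': "Z_square n \<sigma> w t ?x' y =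
      (\<Sum>(H, V)\<in>outer_states n \<sigma> w i. outer_weight n t x y i (H, V) * strip V (x (Suc i)) (x i) (Some ?p, Some ?q))"
    unfolding strip_def using Z_square_two_rows[OF i pq, of \<sigma> t ?x' y] by (simp add: outer_wt)
  have Zs: "Z_square n \<sigma> (w \<circ> simple_refl i) t x y =
      (\<Sum>(H, V)\<in>outer_states n \<sigma> w i. outer_weight n t x y i (H, V) * strip V (x i) (x (Suc i)) (Some ?q, Some ?p))"
    unfolding strip_def using Z_square_two_rows[of i n "w \<circ> simple_refl i" \<sigma> t x y] i pq by (simp add: outer)
  have exchange: "x i * (x (Suc i) - t * x i) * strip V (x (Suc i)) (x i) (Some ?p, Some ?q)
      = strip V (x i) (x (Suc i)) (Some ?p, Some ?q) * ((1 - t) * x i * x (Suc i))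
        + strip V (x i) (x (Suc i)) (Some ?q, Some ?p) * (x (Suc i) * (x i - x (Suc i)))"
    if HV: "(H, V) \<in> outer_states n \<sigma> w i" for H V
  proof -
    have "V (i - 1, j) \<subseteq> {1..n}" if "1 \<le> j" "j \<le> n" for j
    proof -
      have "V \<in> ({0..n} - {i}) \<times> {1..n} \<rightarrow>\<^sub>E Pow {1..n}" using HV by (auto simp: outer_states_def)
      moreover have "(i - 1, j) \<in> ({0..n} - {i}) \<times> {1..n}" using i that by auto
      ultimately show ?thesis by blast
    qed
    note column = two_row_vertex_intertwine[OF x this]
    have "(\<Sum>m\<in>?X. R_entry t (x i) (x (Suc i)) (None, None) m
          * path_sum (\<lambda>j. two_row_vertex n t (x (Suc i)) (x i) (y j) (V (i - 1, j)) (V (Suc i, j))) ?X n m (Some ?p, Some ?q))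
        = (\<Sum>m\<in>?X. strip V (x i) (x (Suc i)) m * R_entry t (x i) (x (Suc i)) m (Some ?p, Some ?q))"
      unfolding strip_def by (rule path_sum_intertwine) (use column pq in auto)
    then show ?thesis
      using pq desc by (simp add: sum_R_entry_left sum_R_entry_right R_simps strip_def)
  qed
  have "x i * (x (Suc i) - t * x i) * Z_square n \<sigma> w t ?x' y
      = (\<Sum>(H, V)\<in>outer_states n \<sigma> w i. outer_weight n t x y i (H, V) *
          (x i * (x (Suc i) - t * x i) * strip V (x (Suc i)) (x i) (Some ?p, Some ?q)))"
    unfolding Z' by (simp add: sum_distrib_left case_prod_unfold mult_ac)
  also have "\<dots> = (\<Sum>(H, V)\<in>outer_states n \<sigma> w i. outer_weight n t x y i (H, V) *
        (strip V (x i) (x (Suc i)) (Some ?p, Some ?q) * ((1 - t) * x i * x (Suc i))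
        + strip V (x i) (x (Suc i)) (Some ?q, Some ?p) * (x (Suc i) * (x i - x (Suc i)))))"
    by (intro sum.cong refl) (auto simp: exchange)
  also have "\<dots> = Z_square n \<sigma> w t x y * ((1 - t) * x i * x (Suc i))
      + Z_square n \<sigma> (w \<circ> simple_refl i) t x y * (x (Suc i) * (x i - x (Suc i)))"
    unfolding Z Zs by (simp add: sum_distrib_right sum.distrib case_prod_unfold distrib_left mult.assoc)
  finally show ?thesis .
qed

section \<open>The partition function of the longest element\<close>

text \<open>
  The three local rules that determine the state with boundary condition \<open>w\<^sub>0\<close>.
\<close>

lemma vertex_empty:
  assumes "vertex_weight t x y None {} L' S' \<noteq> 0"
  shows "L' = None" "S' = {}"
  using assms by (auto simp: vertex_weight_def split: option.splits if_splits)

lemma vertex_foreign_color: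
  assumes "vertex_weight t x y L {j} (Some c) S' \<noteq> 0" "c \<noteq> j"
  shows "L = Some c" "S' = {j}"
  using assms by (auto simp: vertex_weight_def Let_def split: option.splits if_splits)

lemma vertex_turn:
  assumes "vertex_weight t x y None {j} (Some j) S' \<noteq> 0"
  shows "S' = {}"
  using assms by (auto simp: vertex_weight_def Let_def split: option.splits if_splits)

lemma finite_lattice_states: "finite (lattice_states n \<sigma> w)"
  by (rule finite_subset[of _ "({1..n} \<times> {0..n} \<rightarrow>\<^sub>E insert None (Some ` {1..n})) \<times> ({0..n} \<times> {1..n} \<rightarrow>\<^sub>E Pow {1..n})"])
    (auto simp: lattice_states_def intro!: finite_PiE)

text \<open>
  By induction on the rows. On top of row \<open>i\<close> the colors \<open>j \<le> n + 1 - i\<close> are still in their own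
  columns and the other columns are empty. From the left boundary, no color can appear in the empty
  columns. From the right boundary, the color \<open>n + 1 - i\<close> meets only other colors until column
  \<open>n + 1 - i\<close>, so it must go straight. In that column the two parts meet, and its color turns right.
\<close>

lemma staircase_state_unique:
  assumes HV: "(H, V) \<in> lattice_states n id (longest_perm n)"
    and nz: "\<And>i j. i \<in> {1..n} \<Longrightarrow> j \<in> {1..n} \<Longrightarrow>
      vertex_weight t (x i) (y j) (H (i, j)) (V (i - 1, j)) (H (i, j - 1)) (V (i, j)) \<noteq> 0"
  shows "i \<le> n \<Longrightarrow> j \<in> {1..n} \<Longrightarrow> V (i, j) = (if i + j \<le> n then {j} else {})"
    and "i \<in> {1..n} \<Longrightarrow> j \<le> n \<Longrightarrow> H (i, j) = (if i + j \<le> n then Some (n + 1 - i) else None)"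
proof -
  have top: "V (0, j) = {j}" if "j \<in> {1..n}" for j
    using HV that by (auto simp: lattice_states_def)
  have right: "H (i, 0) = Some (n + 1 - i)" and left: "H (i, n) = None" if "i \<in> {1..n}" for i
    using HV that by (auto simp: lattice_states_def longest_perm_def)
  have row: "(\<forall>j\<le>n. H (i, j) = (if i + j \<le> n then Some (n + 1 - i) else None)) \<and>
      (\<forall>j\<in>{1..n}. V (i, j) = (if i + j \<le> n then {j} else {}))"
    if i: "i \<in> {1..n}" and above: "\<forall>j\<in>{1..n}. V (i - 1, j) = (if i - 1 + j \<le> n then {j} else {})" for i
  proof -
    \<comment> \<open>From the left boundary up to column \<open>n + 1 - i\<close>.\<close>
    have uncolored: "H (i, j) = None" if "n + 1 - i \<le> j" "j \<le> n" for j
      using that(2,1)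
    proof (induction j rule: inc_induct)
      case base
      show ?case by (rule left[OF i])
    next
      case (step j)
      have "V (i - 1, Suc j) = {}" using above i step by auto
      moreover have "vertex_weight t (x i) (y (Suc j)) (H (i, Suc j)) (V (i - 1, Suc j)) (H (i, j)) (V (i, Suc j)) \<noteq> 0"
        using nz[OF i, of "Suc j"] step by simp
      moreover have "H (i, Suc j) = None" using step by simp
      ultimately show ?case using vertex_empty(1) by metis
    qed
    \<comment> \<open>From the right boundary up to the right edge of column \<open>n + 1 - i\<close>.\<close>
    have colored: "H (i, j) = Some (n + 1 - i)" if "i + j \<le> n" for j
      using that
    proof (induction j)
      case 0
      show ?case by (rule right[OF i])
    next
      case (Suc j)
      have "V (i - 1, Suc j) = {Suc j}" using above i Suc.prems by auto
      moreover have "n + 1 - i \<noteq> Suc j" using Suc.prems by auto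
      moreover have "vertex_weight t (x i) (y (Suc j)) (H (i, Suc j)) (V (i - 1, Suc j)) (H (i, j)) (V (i, Suc j)) \<noteq> 0"
        using nz[OF i, of "Suc j"] Suc.prems by simp
      moreover have "H (i, j) = Some (n + 1 - i)" using Suc by simp
      ultimately show ?case using vertex_foreign_color(1) by metis
    qed
    have "V (i, j) = (if i + j \<le> n then {j} else {})" if j: "j \<in> {1..n}" for j
    proof -
      consider "i + j \<le> n" | "i + j = n + 1" | "i + j > n + 1" by linarith
      then show ?thesis
      proof cases
        case 1
        then have "V (i - 1, j) = {j}" "H (i, j - 1) = Some (n + 1 - i)" "n + 1 - i \<noteq> j"
          using above i j colored[of "j - 1"] by auto
        then have "V (i, j) = {j}" using nz[OF i j] vertex_foreign_color(2) by metis
        then show ?thesis using 1 by simp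
      next
        case 2
        then have "V (i - 1, j) = {j}" "H (i, j - 1) = Some j" "H (i, j) = None"
          using above i j colored[of "j - 1"] uncolored[of j] by auto
        then have "V (i, j) = {}" using nz[OF i j] vertex_turn by metis
        then show ?thesis using 2 by simp
      next
        case 3
        then have "V (i - 1, j) = {}" "H (i, j) = None"
          using above i j uncolored[of j] by auto
        then have "V (i, j) = {}" using nz[OF i j] vertex_empty(2) by metis
        then show ?thesis using 3 by simp
      qed
    qed
    moreover have "H (i, j) = (if i + j \<le> n then Some (n + 1 - i) else None)" if "j \<le> n" for j
      using colored[of j] uncolored[of j] that by auto
    ultimately show ?thesis by blast
  qed
  have V: "\<forall>j\<in>{1..n}. V (i, j) = (if i + j \<le> n then {j} else {})" if "i \<le> n" for i
    using that
  proof (induction i)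
    case 0
    then show ?case using top by simp
  next
    case (Suc i)
    then show ?case using row[of "Suc i"] by simp
  qed
  show "i \<le> n \<Longrightarrow> j \<in> {1..n} \<Longrightarrow> V (i, j) = (if i + j \<le> n then {j} else {})"
    using V by blast
  show "i \<in> {1..n} \<Longrightarrow> j \<le> n \<Longrightarrow> H (i, j) = (if i + j \<le> n then Some (n + 1 - i) else None)"
    using row[of i] V[of "i - 1"] by auto
qed

lemma card_staircase: "card {(i, j). 1 \<le> i \<and> 1 \<le> j \<and> i + j \<le> n} = n choose 2"
proof -
  have "{(i, j). 1 \<le> i \<and> 1 \<le> j \<and> i + j \<le> n} = Sigma {1..n} (\<lambda>i. {1..n - i})" by auto
  then have "card {(i, j). 1 \<le> i \<and> 1 \<le> j \<and> i + j \<le> n} = (\<Sum>i\<in>{1..n}. n - i)" by simp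
  also have "\<dots> = n choose 2"
  proof (induction n)
    case (Suc n)
    have "(\<Sum>i\<in>{1..Suc n}. Suc n - i) = (\<Sum>i\<in>{1..n}. Suc (n - i))"
      by (simp add: Suc_diff_le)
    also have "\<dots> = (n choose 2) + n" using Suc by (simp add: sum_Suc)
    finally show ?case by (simp add: numeral_2_eq_2)
  qed simp
  finally show ?thesis .
qed

text \<open>
  The vertices with \<open>i + j \<le> n\<close>, where the horizontal color \<open>n + 1 - i\<close> crosses the smaller
  vertical color \<open>j\<close>, have weight \<open>- (1 - x i / y j)\<close>; all other vertices have weight \<open>1\<close>.
\<close>

lemma Z_square_longest_perm:
  fixes x y :: "nat \<Rightarrow> 'a::field"
  assumes x: "\<And>i. i \<in> {1..n} \<Longrightarrow> x i \<noteq> 0"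
  shows "Z_square n id (longest_perm n) t x y =
    (- 1) ^ (n choose 2) * (\<Prod>(i, j) | 1 \<le> i \<and> 1 \<le> j \<and> i + j \<le> n. 1 - x i / y j)"
proof -
  let ?A = "{(i, j). 1 \<le> i \<and> 1 \<le> j \<and> i + j \<le> n}"
  define weight where "weight = (\<lambda>(H, V). \<Prod>(i, j)\<in>{1..n} \<times> {1..n}.
      vertex_weight t (x i) (y j) (H (i, j)) (V (i - 1, j)) (H (i, j - 1)) (V (i, j)))"
  define H0 where "H0 = (\<lambda>(i, j)\<in>{1..n} \<times> {0..n}. if i + j \<le> n then Some (n + 1 - i) else None)"
  define V0 where "V0 = (\<lambda>(i, j)\<in>{0..n} \<times> {1..n}. if i + j \<le> n then {j} else {})"
  have mem: "(H0, V0) \<in> lattice_states n id (longest_perm n)"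
  proof -
    have "Some (Suc n - i) \<in> Some ` {Suc 0..n}" if "Suc 0 \<le> i" "i + j \<le> n" for i j
      using that by (intro imageI) auto
    then have "H0 \<in> {1..n} \<times> {0..n} \<rightarrow>\<^sub>E insert None (Some ` {1..n})"
      unfolding H0_def by (intro PiE_I) (auto split: if_splits)
    moreover have "V0 \<in> {0..n} \<times> {1..n} \<rightarrow>\<^sub>E Pow {1..n}"
      unfolding V0_def by (intro PiE_I) (auto split: if_splits)
    ultimately show ?thesis
      unfolding lattice_states_def by (auto simp: H0_def V0_def longest_perm_def)
  qed
  have only: "(H, V) = (H0, V0)"
    if HV: "(H, V) \<in> lattice_states n id (longest_perm n)" and nz: "weight (H, V) \<noteq> 0" for H V
  proof -
    have "vertex_weight t (x i) (y j) (H (i, j)) (V (i - 1, j)) (H (i, j - 1)) (V (i, j)) \<noteq> 0"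
      if "i \<in> {1..n}" "j \<in> {1..n}" for i j
      using nz that by (auto simp: weight_def)
    note eqs = staircase_state_unique[OF HV this]
    have "H \<in> {1..n} \<times> {0..n} \<rightarrow>\<^sub>E insert None (Some ` {1..n})" "V \<in> {0..n} \<times> {1..n} \<rightarrow>\<^sub>E Pow {1..n}"
      using HV by (simp_all add: lattice_states_def)
    then have ext: "H \<in> extensional ({1..n} \<times> {0..n})" "V \<in> extensional ({0..n} \<times> {1..n})"
      by (simp_all add: PiE_iff)
    have "H = H0"
      by (rule extensionalityI[OF ext(1)]) (use eqs(2) in \<open>auto simp: H0_def\<close>)
    moreover have "V = V0"
      by (rule extensionalityI[OF ext(2)]) (use eqs(1) in \<open>auto simp: V0_def\<close>)
    ultimately show ?thesis by simp
  qed
  have local_weight: "vertex_weight t (x i) (y j) (H0 (i, j)) (V0 (i - 1, j)) (H0 (i, j - 1)) (V0 (i, j))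
      = (if i + j \<le> n then - (1 - x i / y j) else 1)" if ij: "i \<in> {1..n}" "j \<in> {1..n}" for i j
  proof -
    consider "i + j \<le> n" | "i + j = n + 1" | "i + j > n + 1" by linarith
    then show ?thesis
    proof cases
      case 1
      then have less: "j < n + 1 - i" by linarith
      have "H0 (i, j) = Some (n + 1 - i)" "V0 (i - 1, j) = {j}" "H0 (i, j - 1) = Some (n + 1 - i)"
        "V0 (i, j) = {j}"
        using 1 ij by (auto simp: H0_def V0_def)
      moreover have empty: "{a. a = j \<and> Suc n - i < a} = {}" and "n + 1 - i \<noteq> j" using less by auto
      ultimately have "vertex_weight t (x i) (y j) (H0 (i, j)) (V0 (i - 1, j)) (H0 (i, j - 1)) (V0 (i, j))
          = x i * (- inverse (x i) + inverse (y j))"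
        unfolding vertex_weight_def Let_def by (simp add: empty)
      also have "\<dots> = - (1 - x i / y j)"
        using x[OF ij(1)] by (simp add: right_diff_distrib divide_inverse)
      finally show ?thesis using 1 by simp
    next
      case 2
      have "H0 (i, j) = None" "V0 (i - 1, j) = {j}" "H0 (i, j - 1) = Some j" "V0 (i, j) = {}"
        using 2 ij by (auto simp: H0_def V0_def)
      moreover have empty: "{a. a = j \<and> a < j} = {}" "{a. a = j \<and> j < a} = {}" by auto
      ultimately show ?thesis using 2 unfolding vertex_weight_def Let_def by (simp add: empty)
    next
      case 3
      then have "H0 (i, j) = None" "V0 (i - 1, j) = {}" "H0 (i, j - 1) = None" "V0 (i, j) = {}"
        using ij by (auto simp: H0_def V0_def)
      then show ?thesis using 3 by (simp add: vertex_weight_def)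
    qed
  qed
  have "Z_square n id (longest_perm n) t x y = sum weight (lattice_states n id (longest_perm n))"
    by (simp add: Z_square_def weight_def)
  also have "\<dots> = sum weight {(H0, V0)}"
  proof (rule sum.mono_neutral_right[OF finite_lattice_states])
    show "\<forall>s\<in>lattice_states n id (longest_perm n) - {(H0, V0)}. weight s = 0"
      using only by (metis DiffE insertI1 prod.collapse)
  qed (use mem in simp)
  also have "\<dots> = (\<Prod>(i, j)\<in>{1..n} \<times> {1..n}. if i + j \<le> n then - (1 - x i / y j) else 1)"
  proof -
    have "weight (H0, V0) = (\<Prod>(i, j)\<in>{1..n} \<times> {1..n}. if i + j \<le> n then - (1 - x i / y j) else 1)"
      unfolding weight_def split_conv
    proof (rule prod.cong[OF refl])
      fix p assume "p \<in> {1..n} \<times> {1..n}"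
      then show "(case p of (i, j) \<Rightarrow>
            vertex_weight t (x i) (y j) (H0 (i, j)) (V0 (i - 1, j)) (H0 (i, j - 1)) (V0 (i, j)))
          = (case p of (i, j) \<Rightarrow> if i + j \<le> n then - (1 - x i / y j) else 1)"
        using local_weight[of "fst p" "snd p"] by (simp add: case_prod_unfold mem_Times_iff)
    qed
    then show ?thesis by simp
  qed
  also have "\<dots> = (\<Prod>(i, j)\<in>?A. - (1 - x i / y j))"
  proof -
    have "?A = {p \<in> {1..n} \<times> {1..n}. fst p + snd p \<le> n}" by auto
    then show ?thesis by (simp only: prod.inter_filter finite_cartesian_product finite_atLeastAtMost case_prod_unfold)
  qed
  also have "\<dots> = (- 1) ^ card ?A * (\<Prod>(i, j)\<in>?A. 1 - x i / y j)"
    by (simp add: case_prod_unfold flip: prod_uminus)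
  finally show ?thesis unfolding card_staircase .
qed

section \<open>The action on the field of rational functions\<close>

lemma swap_x_zero [simp]: "swap_x i 0 = 0"
  by (metis add.right_neutral add_left_cancel swap_x_add)

lemma swap_x_uminus: "swap_x i (- f) = - swap_x i f"
  using swap_x_add[of i f "- f"] by (simp add: eq_neg_iff_add_eq_0 add.commute)

lemma swap_x_diff: "swap_x i (f - g) = swap_x i f - swap_x i g"
  using swap_x_add[of i f "- g"] by (simp add: swap_x_uminus)

lemma swap_x_inverse: "swap_x i (inverse f) = inverse (swap_x i f)"
proof (cases "f = 0")
  case False
  then have "swap_x i f * swap_x i (inverse f) = 1"
    by (simp add: swap_x_one flip: swap_x_mult)
  then show ?thesis by (simp add: inverse_unique)
qed simp

lemma swap_x_power: "swap_x i (f ^ k) = swap_x i f ^ k"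
  by (induction k) (simp_all add: swap_x_one swap_x_mult)

lemma swap_x_sum: "swap_x i (sum f A) = (\<Sum>a\<in>A. swap_x i (f a))"
  by (induction A rule: infinite_finite_induct) (simp_all add: swap_x_add)

lemma swap_x_prod: "swap_x i (prod f A) = (\<Prod>a\<in>A. swap_x i (f a))"
  by (induction A rule: infinite_finite_induct) (simp_all add: swap_x_mult swap_x_one)

lemma swap_x_vertex_weight:
  "swap_x i (vertex_weight t x y L S L' S') =
     vertex_weight (swap_x i t) (swap_x i x) (swap_x i y) L S L' S'"
  by (auto simp: vertex_weight_def Let_def swap_x_mult swap_x_add swap_x_diff swap_x_uminus
      swap_x_power swap_x_inverse swap_x_one split: option.split)

lemma swap_x_Z_square:
  assumes "\<And>j. swap_x i (y j) = y j"
  shows "swap_x i (Z_square n \<sigma> w tvar xvar y) = Z_square n \<sigma> w tvar (xvar \<circ> transpose i (Suc i)) y"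
  using assms
  by (simp add: Z_square_def swap_x_sum swap_x_prod case_prod_unfold swap_x_vertex_weight
      swap_x_tvar swap_x_xvar)

lemma indet_poly_eq_iff: "indet_poly u = indet_poly v \<longleftrightarrow> u = v"
proof
  assume "indet_poly u = indet_poly v"
  then have "Poly_Mapping.keys (indet_poly u) = Poly_Mapping.keys (indet_poly v)" by simp
  then have "Poly_Mapping.keys (Poly_Mapping.single u (1::nat)) = Poly_Mapping.keys (Poly_Mapping.single v (1::nat))"
    by (simp add: indet_poly_def)
  then show "u = v" by simp
qed simp

lemma indet_poly_nonzero: "indet_poly v \<noteq> 0"
  by (metis indet_poly_def keys_single keys_zero insert_not_empty one_neq_zero)

lemma xvar_nonzero [simp]: "xvar i \<noteq> 0"
  by (simp add: xvar_def Zero_fract_def eq_fract indet_poly_nonzero)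

lemma xvar_eq_iff [simp]: "xvar i = xvar j \<longleftrightarrow> i = j"
  by (simp add: xvar_def eq_fract indet_poly_eq_iff)

text \<open>
  As exchanging two row parameters is the action of \<open>swap_x\<close>, the exchange relation is the
  recursion by \<open>T\<^sub>i\<close> with denominators cleared.
\<close>

lemma Z_square_T_op:
  assumes w: "w permutes {1..n}" and i: "1 \<le> i" "i < n" and desc: "w (Suc i) < w i"
    and y: "\<And>j. swap_x i (y j) = y j"
  shows "Z_square n \<sigma> (w \<circ> simple_refl i) tvar xvar y = T_op i (Z_square n \<sigma> w tvar xvar y)"
proof -
  let ?x1 = "xvar i" and ?x2 = "xvar (Suc i)" and ?t = tvar
  define F where "F = Z_square n \<sigma> w tvar xvar y"
  define G where "G = Z_square n \<sigma> (w \<circ> simple_refl i) tvar xvar y"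
  have rel: "?x1 * (?x2 - ?t * ?x1) * swap_x i F = F * ((1 - ?t) * ?x1 * ?x2) + G * (?x2 * (?x1 - ?x2))"
    using Z_square_exchange[OF w i desc xvar_nonzero xvar_nonzero] swap_x_Z_square[OF y]
    by (simp add: F_def G_def)
  have nz: "?x1 - ?x2 \<noteq> 0" "?x1 \<noteq> 0" "?x2 \<noteq> 0" by simp_all
  have denom: "1 - inverse (?x1 / ?x2) = (?x1 - ?x2) / ?x1" using nz by (simp add: field_simps)
  have "T_op i F = (?x1 * (?t - 1) * ?x2 * F + ?x1 * (?x2 - ?t * ?x1) * swap_x i F) / (?x2 * (?x1 - ?x2))"
    unfolding T_op_def Suc_eq_plus1[symmetric] denom using nz by (simp add: divide_simps)
  also have "\<dots> = G * (?x2 * (?x1 - ?x2)) / (?x2 * (?x1 - ?x2))"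
    unfolding rel by (simp add: algebra_simps)
  also have "\<dots> = G" using nz by simp
  finally show ?thesis by (simp add: F_def G_def)
qed

section \<open>The recursively determined families\<close>

lemma longest_perm_permutes: "longest_perm n permutes {1..n}"
  by (rule bij_imp_permutes)
    (auto simp: longest_perm_def intro!: bij_betw_byWitness[where f' = "longest_perm n"])

lemma longest_perm_invol: "longest_perm n (longest_perm n k) = k"
  by (auto simp: longest_perm_def)

lemma longest_perm_comp_descent:
  assumes v: "v permutes {1..n}" and i: "1 \<le> i" "i < n" and up: "v i < v (Suc i)"
  shows "(longest_perm n \<circ> v) (Suc i) < (longest_perm n \<circ> v) i"
proof -
  have "v i \<in> {1..n}" "v (Suc i) \<in> {1..n}"
    using permutes_in_image[OF v] i by simp_all
  then show ?thesis using up by (simp add: longest_perm_def)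
qed

text \<open>
  A family with the defining properties exists (namely \<open>F\<close>) and is unique, so the definite
  description picks it.
\<close>

lemma MC_X_eqI:
  assumes base: "F id = (\<Prod>(i, j) | 1 \<le> i \<and> i < j \<and> j \<le> n. 1 - xvar i / yvar j)"
    and step: "\<And>w i. w permutes {1..n} \<Longrightarrow> 1 \<le> i \<Longrightarrow> i < n \<Longrightarrow> w i < w (Suc i) \<Longrightarrow>
      F (w \<circ> simple_refl i) = T_op i (F w)"
    and w: "w permutes {1..n}"
  shows "MC_X n w = F w"
proof -
  let ?S = "{w. w permutes {1..n}}"
  have "MC_X n = restrict F ?S"
    unfolding MC_X_def
  proof (rule the_equality, intro conjI allI impI)
    show "restrict F ?S id = (\<Prod>(i, j) | 1 \<le> i \<and> i < j \<and> j \<le> n. 1 - xvar i / yvar j)"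
      by (simp add: base permutes_id)
  next
    fix w i assume w: "w permutes {1..n}" and i: "1 \<le> i" "i < n"
      and up: "bruhat_less n w (w \<circ> simple_refl i)"
    then show "restrict F ?S (w \<circ> simple_refl i) = T_op i (restrict F ?S w)"
      using step[OF w i] comp_simple_refl_permutes[OF w i] bruhat_less_simple_refl_iff[OF w i] by simp
  next
    fix f assume f: "f \<in> extensional ?S \<and>
      f id = (\<Prod>(i, j) | 1 \<le> i \<and> i < j \<and> j \<le> n. 1 - xvar i / yvar j) \<and>
      (\<forall>w i. w permutes {1..n} \<longrightarrow> 1 \<le> i \<longrightarrow> i < n \<longrightarrow>
        bruhat_less n w (w \<circ> simple_refl i) \<longrightarrow> f (w \<circ> simple_refl i) = T_op i (f w))"
    have "f v = F v" if "v permutes {1..n}" for v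
      using that
    proof (rule perm_family_unique[where T = T_op, rotated -1])
      show "f id = F id" using f base by simp
    next
      fix v i assume v: "v permutes {1..n}" and i: "1 \<le> i" "i < n" and up: "v i < v (Suc i)"
      show "F (v \<circ> simple_refl i) = T_op i (F v)" by (rule step[OF v i up])
      show "f (v \<circ> simple_refl i) = T_op i (f v)"
        using f v i up bruhat_less_simple_refl_iff[OF v i] by blast
    qed
    then show "f = restrict F ?S"
      using f by (intro extensionalityI[of _ ?S]) auto
  qed simp
  then show ?thesis using w by simp
qed

text \<open>
  Composition with \<open>w\<^sub>0\<close> on the left turns descents into ascents and \<open>w\<^sub>0\<close> into the identity, which
  reduces uniqueness to the propagation from the identity.
\<close>

lemma MC_Y_eqI:
  assumes base: "F (longest_perm n) = (\<Prod>(i, j) | 1 \<le> i \<and> 1 \<le> j \<and> i + j \<le> n. 1 - xvar i / yvar j)"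
    and step: "\<And>w i. w permutes {1..n} \<Longrightarrow> 1 \<le> i \<Longrightarrow> i < n \<Longrightarrow> w (Suc i) < w i \<Longrightarrow>
      F (w \<circ> simple_refl i) = T_op i (F w)"
    and w: "w permutes {1..n}"
  shows "MC_Y n w = F w"
proof -
  let ?S = "{w. w permutes {1..n}}" and ?w0 = "longest_perm n"
  have w0_perm: "?w0 \<circ> v permutes {1..n}" if "v permutes {1..n}" for v
    using permutes_compose[OF that longest_perm_permutes] .
  have "MC_Y n = restrict F ?S"
    unfolding MC_Y_def
  proof (rule the_equality, intro conjI allI impI)
    show "restrict F ?S ?w0 = (\<Prod>(i, j) | 1 \<le> i \<and> 1 \<le> j \<and> i + j \<le> n. 1 - xvar i / yvar j)"
      using base longest_perm_permutes[of n] by simp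
  next
    fix w i assume w: "w permutes {1..n}" and i: "1 \<le> i" "i < n"
      and up: "bruhat_less n (w \<circ> simple_refl i) w"
    then show "restrict F ?S (w \<circ> simple_refl i) = T_op i (restrict F ?S w)"
      using step[OF w i] comp_simple_refl_permutes[OF w i] bruhat_greater_simple_refl_iff[OF w i] by simp
  next
    fix f assume f: "f \<in> extensional ?S \<and>
      f ?w0 = (\<Prod>(i, j) | 1 \<le> i \<and> 1 \<le> j \<and> i + j \<le> n. 1 - xvar i / yvar j) \<and>
      (\<forall>w i. w permutes {1..n} \<longrightarrow> 1 \<le> i \<longrightarrow> i < n \<longrightarrow>
        bruhat_less n (w \<circ> simple_refl i) w \<longrightarrow> f (w \<circ> simple_refl i) = T_op i (f w))"
    have eq: "f (?w0 \<circ> v) = F (?w0 \<circ> v)" if "v permutes {1..n}" for v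
      using that
    proof (rule perm_family_unique[where T = T_op and f = "\<lambda>v. f (?w0 \<circ> v)" and g = "\<lambda>v. F (?w0 \<circ> v)", rotated -1])
      show "f (?w0 \<circ> id) = F (?w0 \<circ> id)" using f base by simp
    next
      fix v i assume v: "v permutes {1..n}" and i: "1 \<le> i" "i < n" and up: "v i < v (Suc i)"
      show "F (?w0 \<circ> (v \<circ> simple_refl i)) = T_op i (F (?w0 \<circ> v))"
        using step[OF w0_perm[OF v] i longest_perm_comp_descent[OF v i up]] unfolding comp_assoc .
      show "f (?w0 \<circ> (v \<circ> simple_refl i)) = T_op i (f (?w0 \<circ> v))"
        using f w0_perm[OF v] i longest_perm_comp_descent[OF v i up]
          bruhat_greater_simple_refl_iff[OF w0_perm[OF v] i]
        unfolding comp_assoc[symmetric] by blast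
    qed
    have "f v = F v" if "v permutes {1..n}" for v
    proof -
      have "?w0 \<circ> (?w0 \<circ> v) = v" by (simp add: fun_eq_iff longest_perm_invol)
      then show ?thesis using eq[OF w0_perm[OF that]] by simp
    qed
    then show "f = restrict F ?S"
      using f by (intro extensionalityI[of _ ?S]) auto
  qed simp
  then show ?thesis using w by simp
qed

theorem corollary5p10:
  fixes n :: nat and w :: "nat \<Rightarrow> nat"
  assumes "w permutes {1..n}"
  shows "MC_X n w =
           (- 1) ^ (n choose 2) * Z_square n id (longest_perm n \<circ> w) tvar xvar (yvar \<circ> longest_perm n)
       \<and> MC_Y n w = (- 1) ^ (n choose 2) * Z_square n id w tvar xvar yvar"
proof
  let ?sgn = "(- 1) ^ (n choose 2) :: ratfun" and ?w0 = "longest_perm n"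
  have sgn: "?sgn * (?sgn * f) = f" for f
    by (simp flip: mult.assoc power_mult_distrib)
  have T_sgn: "T_op i (?sgn * f) = ?sgn * T_op i f" for i f
    by (simp add: T_op_def swap_x_mult swap_x_power swap_x_uminus swap_x_one algebra_simps)
  show "MC_X n w = ?sgn * Z_square n id (?w0 \<circ> w) tvar xvar (yvar \<circ> ?w0)"
    using _ _ assms
  proof (rule MC_X_eqI)
    have "(\<Prod>(i, j) | 1 \<le> i \<and> 1 \<le> j \<and> i + j \<le> n. 1 - xvar i / yvar (?w0 j))
        = (\<Prod>(i, j) | 1 \<le> i \<and> i < j \<and> j \<le> n. 1 - xvar i / yvar j)"
      by (rule prod.reindex_bij_witness[where i = "\<lambda>(i, j). (i, n + 1 - j)" and j = "\<lambda>(i, j). (i, n + 1 - j)"])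
        (auto simp: longest_perm_def)
    then show "?sgn * Z_square n id (?w0 \<circ> id) tvar xvar (yvar \<circ> ?w0)
        = (\<Prod>(i, j) | 1 \<le> i \<and> i < j \<and> j \<le> n. 1 - xvar i / yvar j)"
      by (simp add: Z_square_longest_perm sgn)
  next
    fix v i assume v: "v permutes {1..n}" and i: "1 \<le> i" "i < n" and up: "v i < v (Suc i)"
    have "(?w0 \<circ> v) (Suc i) < (?w0 \<circ> v) i"
      by (rule longest_perm_comp_descent[OF v i up])
    then have "Z_square n id (?w0 \<circ> v \<circ> simple_refl i) tvar xvar (yvar \<circ> ?w0)
        = T_op i (Z_square n id (?w0 \<circ> v) tvar xvar (yvar \<circ> ?w0))"
      by (intro Z_square_T_op i permutes_compose[OF v longest_perm_permutes]) (simp_all add: swap_x_yvar)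
    then show "?sgn * Z_square n id (?w0 \<circ> (v \<circ> simple_refl i)) tvar xvar (yvar \<circ> ?w0)
        = T_op i (?sgn * Z_square n id (?w0 \<circ> v) tvar xvar (yvar \<circ> ?w0))"
      by (simp add: T_sgn comp_assoc)
  qed
  show "MC_Y n w = ?sgn * Z_square n id w tvar xvar yvar"
    using _ _ assms
  proof (rule MC_Y_eqI)
    show "?sgn * Z_square n id ?w0 tvar xvar yvar
        = (\<Prod>(i, j) | 1 \<le> i \<and> 1 \<le> j \<and> i + j \<le> n. 1 - xvar i / yvar j)"
      by (simp add: Z_square_longest_perm sgn)
  next
    fix v i assume v: "v permutes {1..n}" and i: "1 \<le> i" "i < n" and down: "v (Suc i) < v i"
    show "?sgn * Z_square n id (v \<circ> simple_refl i) tvar xvar yvar = T_op i (?sgn * Z_square n id v tvar xvar yvar)"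
      using Z_square_T_op[OF v i down, of yvar id] by (simp add: T_sgn swap_x_yvar)
  qed
qed

end
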